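(* For every $2$-coloring of the edges of $K_{\mathbb{N}}$ there exists a monochromatic path $P$ with $\bar{d}_s(P)\geq 2/3$.
   Context: $K_{\mathbb{N}}$ is the complete graph on the positive integers $\mathbb{N}$. A $2$-coloring is a partition of the edge set into two color classes. A path in $K_{\mathbb{N}}$ is an infinite sequence $(a_1,a_2,\dots)$ of distinct positive integers with edges $a_na_{n+1}$; it is monochromatic if all these edges have the same color. For an infinite sequence $A=(a_1,a_2,\dots)$ of distinct positive integers let $f(n)=\sup\{m : \{a_1,\dots,a_m\}\subseteq\{1,\dots,n\}\}$; the strong upper density of $A$ is $\bar{d}_s(A)=\limsup_{n\to\infty} f(n)/n$. The strong upper density of a path is that of its vertex sequence $(a_1,a_2,\dots)$. *)

theory Defs
  imports "HOL-Library.Ramsey" "HOL-Library.Liminf_Limsup" "HOL-Library.Extended_Real"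
begin

text \<open>
  The positive integers are \<open>{1..} :: nat set\<close>. An infinite sequence \<open>(a\<^sub>1, a\<^sub>2, \<dots>)\<close> is a
  function \<open>a :: nat \<Rightarrow> nat\<close> with the index shifted by one: \<open>a i\<close> is the term \<open>a\<^sub>i\<^sub>+\<^sub>1\<close>, so that
  \<open>{a\<^sub>1, \<dots>, a\<^sub>m} = a ` {..<m}\<close>.
\<close>

definition KN_edges :: "nat set set"
  where "KN_edges = nsets {1..} 2"

text \<open>A colour class may be empty.\<close>

definition two_colouring :: "nat set set \<Rightarrow> nat set set \<Rightarrow> bool"
  where "two_colouring R B \<longleftrightarrow> R \<union> B = KN_edges \<and> R \<inter> B = {}"

definition KN_path :: "(nat \<Rightarrow> nat) \<Rightarrow> bool"
  where "KN_path a \<longleftrightarrow> inj a \<and> range a \<subseteq> {1..}"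

definition path_edges :: "(nat \<Rightarrow> nat) \<Rightarrow> nat set set"
  where "path_edges a = {{a i, a (Suc i)} | i. True}"

definition monochromatic_path :: "nat set set \<Rightarrow> nat set set \<Rightarrow> (nat \<Rightarrow> nat) \<Rightarrow> bool"
  where "monochromatic_path R B a \<longleftrightarrow> path_edges a \<subseteq> R \<or> path_edges a \<subseteq> B"

text \<open>
  For injective \<open>a\<close> with positive values the set below contains \<open>0\<close> and is bounded by \<open>n\<close>,
  so the supremum in \<open>nat\<close> is a genuine one.
\<close>

definition initial_count :: "(nat \<Rightarrow> nat) \<Rightarrow> nat \<Rightarrow> nat"
  where "initial_count a n = Sup {m. a ` {..<m} \<subseteq> {1..n}}"

definition strong_upper_density :: "(nat \<Rightarrow> nat) \<Rightarrow> ereal"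
  where "strong_upper_density a = limsup (\<lambda>n. ereal (real (initial_count a n) / real n))"

end

(*
  Suppose first that for some finite F and infinitely many n all components of {1..n} - F in one colour
  have fewer than 2n/3 vertices. Then the other colour contains a complete multipartite graph on
  {1..n} - F, whose paths of length about 2n/3 extend any given path. Otherwise both colours have, for
  every finite F, a giant component in {1..n} - F for all large n; these are nested in n and form the
  core of N - F. A path is extended repeatedly, always ending at a vertex from which the core of its
  complement can be reached (an exit).

  Suppose that both colours get stuck. If more than about a third of {1..n} were no exits in one
  colour, they would be joined completely in the other colour to the core beyond n, and at a suitable
  N > n this gives a long path. Now compare longest paths from the two starting points to exits in
  {1..n}; let P be the longer one, red, say, with p < 2n/3 vertices, and Y the set of vertices off P.
  As P cannot be rerouted through Y, each vertex of Y is joined in blue to one of any two consecutive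
  vertices of P, and two vertices of Y have a common blue neighbour among any four. A blue path
  zigzags between Y and P and has about p vertices. If Y contains a blue path of suitable constant
  length, including it gives a blue path longer than P. Otherwise red is nearly complete in Y;
  then P would be short compared to red paths through Y, or Y is joined in blue to a third of {1..n}.
*)

theory Submission
  imports Defs "HOL-Library.Sublist"
begin

section \<open>Monochromatic paths and components\<close>

text \<open>A long path inside \<open>{1..n}\<close> is worthless if it cannot be continued beyond
  \<open>n\<close>; this obstacle is the reason for exits. The value 2/3 enters in several ways. Two
  components with at least 2n/3 of the vertices overlap, whatever their colours. Hence giant
  components for \<open>n\<close> and \<open>n + 1\<close> coincide, and the cores of the two
  colours share vertices beyond any bound, so that a vertex which is no exit in one colour is an
  exit in the other. Any set with more than n/3 vertices meets a giant component, which is how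
  routes enter \<open>Y\<close>. Finally, the zigzag takes one vertex of \<open>Y\<close> for two of
  \<open>P\<close>, so it needs p/2 vertices off \<open>P\<close>, and p/2 < n - p holds for p <
  2n/3. The number \<open>n div k\<close> plays the role of epsilon times n. All other losses depend
  on fixed finite sets only and are absorbed by it for large \<open>n\<close>. The "suitable
  constant length" of the blue path in \<open>Y\<close> is chosen just large enough to outweigh the
  losses of the zigzag.\<close>

lemma split_list_butlast:
  assumes "z \<in> set (butlast xs)"
  shows "\<exists>us ws. xs = us @ z # ws \<and> ws \<noteq> []"
proof -
  obtain us vs where "butlast xs = us @ z # vs"
    using assms by (meson split_list)
  moreover have "xs = butlast xs @ [last xs]"
    using assms by (cases xs) auto
  ultimately have "xs = us @ z # (vs @ [last xs])"
    by (metis append.assoc append_Cons)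
  then show ?thesis
    by blast
qed

text \<open>Colours are truth values, so that each lemma serves both colours, with
  \<open>\<not> c\<close> as the other one. Vertices are arbitrary natural numbers; positivity
  enters through sets such as \<open>{1..n}\<close>.\<close>

locale edge_colouring =
  fixes adj :: "bool \<Rightarrow> nat \<Rightarrow> nat \<Rightarrow> bool"
  assumes adj_sym: "adj c x y \<Longrightarrow> adj c y x"
    and adj_irrefl: "\<not> adj c x x"
    and adj_total: "x \<noteq> y \<Longrightarrow> \<not> adj c x y \<Longrightarrow> adj (\<not> c) x y"
begin

lemma adj_total': "x \<noteq> y \<Longrightarrow> \<not> adj (\<not> c) x y \<Longrightarrow> adj c x y"
  using adj_total by blast

definition pth :: "bool \<Rightarrow> nat list \<Rightarrow> bool"
  where "pth c xs \<longleftrightarrow> distinct xs \<and> successively (adj c) xs"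

lemma pth_Nil [simp]: "pth c []"
  by (simp add: pth_def)

lemma pth_single [simp]: "pth c [x]"
  by (simp add: pth_def)

lemma pth_Cons: "pth c (x # xs) \<longleftrightarrow> x \<notin> set xs \<and> pth c xs \<and> (xs = [] \<or> adj c x (hd xs))"
  by (auto simp: pth_def successively_Cons)

lemma pth_append:
  "pth c (xs @ ys) \<longleftrightarrow> pth c xs \<and> pth c ys \<and> set xs \<inter> set ys = {} \<and>
     (xs = [] \<or> ys = [] \<or> adj c (last xs) (hd ys))"
  by (auto simp: pth_def successively_append_iff)

lemma pth_rev [simp]: "pth c (rev xs) \<longleftrightarrow> pth c xs"
proof -
  have "successively (\<lambda>x y. adj c y x) xs \<longleftrightarrow> successively (adj c) xs"
    by (rule successively_cong) (auto intro: adj_sym)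
  then show ?thesis
    by (simp add: pth_def)
qed

lemma pth_take: "pth c xs \<Longrightarrow> pth c (take n xs)"
  using pth_append[of c "take n xs" "drop n xs"] by simp

lemma pth_drop: "pth c xs \<Longrightarrow> pth c (drop n xs)"
  using pth_append[of c "take n xs" "drop n xs"] by simp

lemma pth_distinct: "pth c xs \<Longrightarrow> distinct xs"
  by (simp add: pth_def)

lemma pth_length: "pth c xs \<Longrightarrow> length xs = card (set xs)"
  by (simp add: pth_def distinct_card)

lemma pth_nth_adj: "pth c xs \<Longrightarrow> Suc i < length xs \<Longrightarrow> adj c (xs ! i) (xs ! Suc i)"
  by (simp add: pth_def successively_conv_nth)

definition link :: "bool \<Rightarrow> nat set \<Rightarrow> nat \<Rightarrow> nat \<Rightarrow> bool"
  where "link c W x y \<longleftrightarrow> x \<in> W \<and> y \<in> W \<and> adj c x y"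

text \<open>Without the guard, a vertex off \<open>W\<close> would have the component
  \<open>{x}\<close>; with it, a positive lower bound on the size also certifies
  \<open>x \<in> W\<close>.\<close>

definition comp :: "bool \<Rightarrow> nat set \<Rightarrow> nat \<Rightarrow> nat set"
  where "comp c W x = {y. x \<in> W \<and> (link c W)\<^sup>*\<^sup>* x y}"

lemma link_sym: "link c W x y \<Longrightarrow> link c W y x"
  using adj_sym by (auto simp: link_def)

lemma link_rtranclp_sym: "(link c W)\<^sup>*\<^sup>* x y \<Longrightarrow> (link c W)\<^sup>*\<^sup>* y x"
  by (induction rule: rtranclp_induct) (auto intro: link_sym converse_rtranclp_into_rtranclp)

lemma comp_subset: "comp c W x \<subseteq> W"
proof
  fix y
  assume "y \<in> comp c W x"
  then have "(link c W)\<^sup>*\<^sup>* x y" "x \<in> W"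
    by (auto simp: comp_def)
  then show "y \<in> W"
    by (induction rule: rtranclp_induct) (auto simp: link_def)
qed

lemma comp_self: "x \<in> W \<Longrightarrow> x \<in> comp c W x"
  by (simp add: comp_def)

lemma comp_eq:
  assumes "y \<in> comp c W x"
  shows "comp c W y = comp c W x"
proof -
  have xy: "(link c W)\<^sup>*\<^sup>* x y" "x \<in> W"
    using assms by (auto simp: comp_def)
  have y: "y \<in> W"
    using assms comp_subset by blast
  show ?thesis
    using xy y link_rtranclp_sym[OF xy(1)] rtranclp_trans[of "link c W"] unfolding comp_def by blast
qed

lemma comp_closed:
  assumes "y \<in> comp c W x" "z \<in> W" "adj c y z"
  shows "z \<in> comp c W x"
proof -
  have "link c W y z"
    using assms comp_subset by (auto simp: link_def)
  then show ?thesis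
    using assms(1) by (auto simp: comp_def intro: rtranclp.rtrancl_into_rtrancl)
qed

lemma comp_least:
  assumes "x \<in> A" and closed: "\<And>y z. y \<in> A \<Longrightarrow> z \<in> W \<Longrightarrow> adj c y z \<Longrightarrow> z \<in> A"
  shows "comp c W x \<subseteq> A"
proof
  fix y
  assume "y \<in> comp c W x"
  then have "(link c W)\<^sup>*\<^sup>* x y"
    by (simp add: comp_def)
  then show "y \<in> A"
    by (induction rule: rtranclp_induct) (use assms in \<open>auto simp: link_def\<close>)
qed

lemma comp_mono:
  assumes "W \<subseteq> W'"
  shows "comp c W x \<subseteq> comp c W' x"
proof (cases "x \<in> W")
  case True
  show ?thesis
    by (rule comp_least) (use True assms comp_self comp_closed in blast)+
qed (simp add: comp_def)

lemma comp_path: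
  assumes "y \<in> comp c W x"
  shows "\<exists>xs. pth c xs \<and> xs \<noteq> [] \<and> hd xs = x \<and> last xs = y \<and> set xs \<subseteq> W"
proof -
  have x: "x \<in> W" and "(link c W)\<^sup>*\<^sup>* x y"
    using assms by (auto simp: comp_def)
  from this(2) show ?thesis
  proof (induction rule: rtranclp_induct)
    case base
    show ?case
      using x by (intro exI[of _ "[x]"]) auto
  next
    case (step y z)
    then obtain xs where xs: "pth c xs" "xs \<noteq> []" "hd xs = x" "last xs = y" "set xs \<subseteq> W"
      by blast
    show ?case
    proof (cases "z \<in> set xs")
      case True
      then obtain us vs where "xs = us @ z # vs"
        by (meson split_list)
      then have "xs = (us @ [z]) @ vs"
        by simp
      then show ?thesis
        using xs pth_append[of c "us @ [z]" vs] by (intro exI[of _ "us @ [z]"]) (auto simp: hd_append split: if_splits)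
    next
      case False
      then show ?thesis
        using xs step.hyps by (intro exI[of _ "xs @ [z]"]) (auto simp: pth_append link_def)
    qed
  qed
qed

text \<open>Minimality is taken over all paths in \<open>W\<close> from \<open>f\<close> to any
  vertex of \<open>Y\<close>, so a neighbour in \<open>Y\<close> of an early vertex would allow a
  shortcut. At the vertex before the last such a neighbour saves nothing, hence the double
  \<open>butlast\<close>.\<close>

lemma shortest_path_to_set:
  assumes "y \<in> comp c W f" "y \<in> Y"
  obtains ls where "pth c ls" "ls \<noteq> []" "hd ls = f" "last ls \<in> Y" "set ls \<subseteq> W"
    "set (butlast ls) \<inter> Y = {}"
    "\<And>l z. l \<in> set (butlast (butlast ls)) \<Longrightarrow> z \<in> Y \<Longrightarrow> z \<in> W \<Longrightarrow> \<not> adj c l z"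
proof -
  define Q where "Q ls \<longleftrightarrow> pth c ls \<and> ls \<noteq> [] \<and> hd ls = f \<and> last ls \<in> Y \<and> set ls \<subseteq> W" for ls
  have "\<exists>ls. Q ls"
    using comp_path[OF assms(1)] assms(2) unfolding Q_def by blast
  then obtain ls where ls: "Q ls" and min: "\<And>ls'. Q ls' \<Longrightarrow> length ls \<le> length ls'"
    using ex_has_least_nat[of Q _ length] by blast
  have app: "pth c ls" "ls \<noteq> []" "hd ls = f" "set ls \<subseteq> W"
    using ls by (auto simp: Q_def)
  have pre: "Q (us @ [z])" if "ls = us @ z # ws" "z \<in> Y" for us z ws
    using ls that pth_append[of c "us @ [z]" ws] by (cases us) (auto simp: Q_def)
  have 1: "z \<notin> Y" if zb: "z \<in> set (butlast ls)" for z
  proof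
    assume zY: "z \<in> Y"
    obtain us ws where eq: "ls = us @ z # ws" "ws \<noteq> []"
      using split_list_butlast[OF zb] by blast
    then show False
      using min[OF pre[OF eq(1) zY]] by (cases ws) auto
  qed
  have 2: "\<not> adj c l z" if l: "l \<in> set (butlast (butlast ls))" and z: "z \<in> Y" "z \<in> W" for l z
  proof
    assume lz: "adj c l z"
    obtain us ws where bl: "butlast ls = us @ l # ws" "ws \<noteq> []"
      using split_list_butlast[OF l] by blast
    then obtain ws' where ws': "ls = us @ l # ws @ ws'" "ws' \<noteq> []"
      using app(2) append_butlast_last_id[of ls] by (metis append.assoc append_Cons not_Cons_self2)
    have "set (us @ [l]) \<subseteq> set (butlast ls)"
      unfolding bl by auto
    then have zn: "z \<notin> set (us @ [l])"
      using 1 z by blast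
    moreover have "pth c (us @ [l])"
      using app(1) ws' pth_append[of c "us @ [l]" "ws @ ws'"] by simp
    ultimately have "pth c ((us @ [l]) @ [z])"
      using lz pth_append[of c "us @ [l]" "[z]"] by auto
    then have "Q ((us @ [l]) @ [z])"
      using z app(3,4) ws' by (cases us) (auto simp: Q_def)
    from min[OF this] show False
      using ws' bl by (cases ws; cases ws') auto
  qed
  show thesis
    using that[of ls] ls 1 2 unfolding Q_def by blast
qed

text \<open>The argument of Gerencser and Gyarfas: if the new vertex extends neither path, the colour of
  the edge between the two ends tells which path takes over the end of the other one.\<close>

lemma two_path_partition:
  assumes "finite A"
  shows "\<exists>xs ys. pth c xs \<and> pth (\<not> c) ys \<and> set xs \<inter> set ys = {} \<and> set xs \<union> set ys = A"
  using assms
proof (induction A)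
  case empty
  show ?case
    by (intro exI[of _ "[]"]) auto
next
  case (insert v A)
  then obtain xs ys where xy: "pth c xs" "pth (\<not> c) ys" "set xs \<inter> set ys = {}" "set xs \<union> set ys = A"
    by blast
  then have v: "v \<notin> set xs" "v \<notin> set ys"
    using insert.hyps by auto
  consider "xs = [] \<or> adj c (hd xs) v" | "ys = [] \<or> adj (\<not> c) (hd ys) v"
    | x xs' y ys' where "xs = x # xs'" "ys = y # ys'" "\<not> adj c x v" "\<not> adj (\<not> c) y v"
    by (metis list.sel(1) neq_Nil_conv)
  then show ?case
  proof cases
    case 1
    then have "pth c (v # xs)"
      using xy v adj_sym by (auto simp: pth_Cons)
    then show ?thesis
      using xy v by (intro exI[of _ "v # xs"] exI[of _ ys]) auto
  next
    case 2
    then have "pth (\<not> c) (v # ys)"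
      using xy v adj_sym by (auto simp: pth_Cons)
    then show ?thesis
      using xy v by (intro exI[of _ xs] exI[of _ "v # ys"]) auto
  next
    case 3
    have a: "adj (\<not> c) v x" "adj c v y"
      using 3 v adj_total adj_total' adj_sym by (metis list.set_intros(1))+
    show ?thesis
    proof (cases "adj c x y")
      case True
      then have "pth c (v # y # xs)" "pth (\<not> c) ys'"
        using 3 xy v a adj_sym by (auto simp: pth_Cons)
      then show ?thesis
        using 3 xy v by (intro exI[of _ "v # y # xs"] exI[of _ ys']) (auto simp: pth_Cons)
    next
      case False
      then have "adj (\<not> c) x y"
        using 3 xy(3) adj_total by (metis disjoint_iff list.set_intros(1))
      then have "pth (\<not> c) (v # x # ys)" "pth c xs'"
        using 3 xy v a adj_sym by (auto simp: pth_Cons)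
      then show ?thesis
        using 3 xy v by (intro exI[of _ xs'] exI[of _ "v # x # ys"]) (auto simp: pth_Cons)
    qed
  qed
qed

end

section \<open>Alternating and multipartite paths\<close>

text \<open>The two vertices of a window may coincide: besides pairs of consecutive path vertices,
  one-vertex windows occur in \<open>long_route'\<close>.\<close>

definition wset :: "nat \<times> nat \<Rightarrow> nat set"
  where "wset w = {fst w, snd w}"

context edge_colouring
begin

text \<open>
  An alternating path between \<open>A\<close> and the windows. If the current vertex \<open>y\<close> has no common
  neighbour in a window with any element of \<open>A\<close>, one of the two window vertices is adjacent to all
  of \<open>A\<close>; it is used for an additional step after the next window, so that no window is lost. Windows that
  meet the set \<open>D\<close> of forbidden vertices are skipped.
\<close>

lemma zigzag:
  assumes "finite A" "y \<in> Y" "A \<subseteq> Y" "y \<notin> A" "length ws \<le> card A"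
    and "sorted_wrt (\<lambda>w w'. wset w \<inter> wset w' = {}) ws"
    and "\<And>w. w \<in> set ws \<Longrightarrow> wset w \<inter> Y = {}"
    and "\<And>w a. w \<in> set ws \<Longrightarrow> a \<in> Y \<Longrightarrow> wset w \<inter> D = {} \<Longrightarrow> \<exists>x\<in>wset w. adj c a x"
    and "successively (\<lambda>w w'. wset w \<inter> D = {} \<longrightarrow> wset w' \<inter> D = {} \<longrightarrow>
           (\<forall>a\<in>Y. \<forall>b\<in>Y. a \<noteq> b \<longrightarrow> (\<exists>x\<in>wset w \<union> wset w'. adj c a x \<and> adj c b x))) ws"
  shows "\<exists>zs. pth c zs \<and> zs \<noteq> [] \<and> hd zs = y \<and> last zs \<in> insert y A \<and>
           set zs \<subseteq> insert y A \<union> {x. x \<in> \<Union>(wset ` set ws) \<and> x \<notin> D \<and> (\<exists>a\<in>Y. adj c a x)} \<and>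
           2 * length ws \<le> length zs + 1 + 4 * length (filter (\<lambda>w. wset w \<inter> D \<noteq> {}) ws)"
  using assms
proof (induction ws arbitrary: y A rule: length_induct)
  case (1 ws)
  note prems = "1.prems"
  note IH = "1.IH"[rule_format]
  show ?case
  proof (cases ws)
    case Nil
    then show ?thesis
      by (intro exI[of _ "[y]"]) auto
  next
    case (Cons w ws1)
    have ws1: "sorted_wrt (\<lambda>w w'. wset w \<inter> wset w' = {}) ws1"
      "\<And>w'. w' \<in> set ws1 \<Longrightarrow> wset w \<inter> wset w' = {}"
      using prems(6) Cons by auto
    have succ1: "successively (\<lambda>w w'. wset w \<inter> D = {} \<longrightarrow> wset w' \<inter> D = {} \<longrightarrow>
           (\<forall>a\<in>Y. \<forall>b\<in>Y. a \<noteq> b \<longrightarrow> (\<exists>x\<in>wset w \<union> wset w'. adj c a x \<and> adj c b x))) ws1"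
      using prems(9) Cons by (auto simp: successively_Cons)
    consider (del) "wset w \<inter> D \<noteq> {}"
      | (step) x a where "wset w \<inter> D = {}" "a \<in> A" "x \<in> wset w" "adj c y x" "adj c a x"
      | (fail) "wset w \<inter> D = {}" "\<And>x a. a \<in> A \<Longrightarrow> x \<in> wset w \<Longrightarrow> adj c y x \<Longrightarrow> \<not> adj c a x"
      by blast
    then show ?thesis
    proof cases
      case del
      have "\<exists>zs. pth c zs \<and> zs \<noteq> [] \<and> hd zs = y \<and> last zs \<in> insert y A \<and>
           set zs \<subseteq> insert y A \<union> {x. x \<in> \<Union>(wset ` set ws1) \<and> x \<notin> D \<and> (\<exists>a\<in>Y. adj c a x)} \<and>
           2 * length ws1 \<le> length zs + 1 + 4 * length (filter (\<lambda>w. wset w \<inter> D \<noteq> {}) ws1)"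
        by (rule IH) (use prems Cons ws1 succ1 in auto)
      then obtain zs where zs: "pth c zs" "zs \<noteq> []" "hd zs = y" "last zs \<in> insert y A"
           "set zs \<subseteq> insert y A \<union> {x. x \<in> \<Union>(wset ` set ws1) \<and> x \<notin> D \<and> (\<exists>a\<in>Y. adj c a x)}"
           "2 * length ws1 \<le> length zs + 1 + 4 * length (filter (\<lambda>w. wset w \<inter> D \<noteq> {}) ws1)"
        by blast
      show ?thesis
        by (rule exI[of _ zs]) (use zs Cons del in auto)
    next
      case step
      have "\<exists>zs. pth c zs \<and> zs \<noteq> [] \<and> hd zs = a \<and> last zs \<in> insert a (A - {a}) \<and>
           set zs \<subseteq> insert a (A - {a}) \<union> {x. x \<in> \<Union>(wset ` set ws1) \<and> x \<notin> D \<and> (\<exists>a\<in>Y. adj c a x)} \<and>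
           2 * length ws1 \<le> length zs + 1 + 4 * length (filter (\<lambda>w. wset w \<inter> D \<noteq> {}) ws1)"
        by (rule IH) (use prems Cons ws1 succ1 step in auto)
      then obtain zs where zs: "pth c zs" "zs \<noteq> []" "hd zs = a" "last zs \<in> insert a (A - {a})"
           "set zs \<subseteq> insert a (A - {a}) \<union> {x. x \<in> \<Union>(wset ` set ws1) \<and> x \<notin> D \<and> (\<exists>a\<in>Y. adj c a x)}"
           "2 * length ws1 \<le> length zs + 1 + 4 * length (filter (\<lambda>w. wset w \<inter> D \<noteq> {}) ws1)"
        by blast
      have off: "wset w' \<inter> Y = {}" if "w' \<in> set ws" for w'
        using prems(7) that .
      have xY: "x \<notin> Y"
        using off[of w] Cons step by auto
      have "x \<notin> set zs"
        using zs(5) xY prems(3) ws1(2) step by blast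
      moreover have "y \<notin> set zs"
        using zs(5) prems(2,4) off Cons step(2) by fastforce
      ultimately have "pth c (y # x # zs)"
        using zs step xY prems(2) adj_sym by (auto simp: pth_Cons)
      then show ?thesis
        by (intro exI[of _ "y # x # zs"]) (use zs Cons step prems(2) in auto)
    next
      case fail
      show ?thesis
      proof (cases ws1)
        \<comment> \<open>A last window that fails is given up; this is what the \<open>+ 1\<close>
          in the bound pays for.\<close>
        case Nil
        then show ?thesis
          by (intro exI[of _ "[y]"]) (use Cons in auto)
      next
        case Cons1: (Cons w2 ws2)
        have ws2: "sorted_wrt (\<lambda>w w'. wset w \<inter> wset w' = {}) ws2"
          "\<And>w'. w' \<in> set ws2 \<Longrightarrow> wset w2 \<inter> wset w' = {}"
          using ws1(1) Cons1 by auto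
        have succ2: "successively (\<lambda>w w'. wset w \<inter> D = {} \<longrightarrow> wset w' \<inter> D = {} \<longrightarrow>
           (\<forall>a\<in>Y. \<forall>b\<in>Y. a \<noteq> b \<longrightarrow> (\<exists>x\<in>wset w \<union> wset w'. adj c a x \<and> adj c b x))) ws2"
          using succ1 Cons1 by (auto simp: successively_Cons)
        show ?thesis
        proof (cases "wset w2 \<inter> D = {}")
          \<comment> \<open>Both windows are dropped, although \<open>w\<close> avoids
            \<open>D\<close>. This costs 4 on the left-hand side, hence the factor 4 for each window
            that meets \<open>D\<close>.\<close>
          case False
          have "\<exists>zs. pth c zs \<and> zs \<noteq> [] \<and> hd zs = y \<and> last zs \<in> insert y A \<and>
               set zs \<subseteq> insert y A \<union> {x. x \<in> \<Union>(wset ` set ws2) \<and> x \<notin> D \<and> (\<exists>a\<in>Y. adj c a x)} \<and>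
               2 * length ws2 \<le> length zs + 1 + 4 * length (filter (\<lambda>w. wset w \<inter> D \<noteq> {}) ws2)"
            by (rule IH) (use prems Cons Cons1 ws2 succ2 in auto)
          then obtain zs where zs: "pth c zs" "zs \<noteq> []" "hd zs = y" "last zs \<in> insert y A"
               "set zs \<subseteq> insert y A \<union> {x. x \<in> \<Union>(wset ` set ws2) \<and> x \<notin> D \<and> (\<exists>a\<in>Y. adj c a x)}"
               "2 * length ws2 \<le> length zs + 1 + 4 * length (filter (\<lambda>w. wset w \<inter> D \<noteq> {}) ws2)"
            by blast
          show ?thesis
            by (rule exI[of _ zs]) (use zs Cons Cons1 False in auto)
        next
          case True
          have "2 \<le> card A"
            using prems(5) Cons Cons1 by simp
          then obtain a b where ab: "a \<in> A" "b \<in> A" "a \<noteq> b"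
            using card_le_Suc0_iff_eq[OF prems(1)] by force
          have cA: "length ws2 \<le> card (A - {a} - {b})"
            using ab prems(1,5) Cons Cons1 by simp
          have aY: "a \<in> Y" "y \<noteq> a"
            using ab prems(3,4) by auto
          have "\<exists>x\<in>wset w \<union> wset w2. adj c y x \<and> adj c a x"
            using prems(9) Cons Cons1 fail(1) True aY prems(2) by (auto simp: successively_Cons)
          then obtain x where x: "x \<in> wset w2" "adj c y x" "adj c a x"
            using fail(2)[OF ab(1)] by blast
          obtain u where u: "u \<in> wset w" "adj c y u"
            using prems(8)[of w y] prems(2) fail(1) Cons that by (metis list.set_intros(1))
          \<comment> \<open>Every element of \<open>A\<close> has a neighbour in \<open>w\<close>,
            which is not \<open>u\<close> because the step failed. As \<open>w\<close> has at most
            one other vertex, this is a neighbour of all of \<open>A\<close>.\<close>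
          have "\<exists>v\<in>wset w. \<forall>a\<in>A. adj c a v"
          proof -
            have *: "\<exists>v\<in>wset w. adj c a' v \<and> v \<noteq> u" if "a' \<in> A" for a'
            proof -
              have "w \<in> set ws" "a' \<in> Y"
                using Cons that prems(3) by auto
              then obtain v where "v \<in> wset w" "adj c a' v"
                using prems(8) fail(1) by blast
              then show ?thesis
                using fail(2)[OF that u] by blast
            qed
            show ?thesis
            proof (cases "u = fst w")
              case True
              then show ?thesis
                using * by (intro bexI[of _ "snd w"]) (auto simp: wset_def)
            next
              case False
              then show ?thesis
                using * u(1) by (intro bexI[of _ "fst w"]) (auto simp: wset_def)
            qed
          qed
          then obtain v where v: "v \<in> wset w" "\<And>a. a \<in> A \<Longrightarrow> adj c a v"
            by blast
          \<comment> \<open>The path is y, x, a, v, b, ... with \<open>x\<close> in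
            \<open>w2\<close> and \<open>v\<close> in \<open>w\<close>: the two windows are used in
            reverse order and yield four vertices.\<close>
          have "\<exists>zs. pth c zs \<and> zs \<noteq> [] \<and> hd zs = b \<and> last zs \<in> insert b (A - {a} - {b}) \<and>
               set zs \<subseteq> insert b (A - {a} - {b}) \<union> {x. x \<in> \<Union>(wset ` set ws2) \<and> x \<notin> D \<and> (\<exists>a\<in>Y. adj c a x)} \<and>
               2 * length ws2 \<le> length zs + 1 + 4 * length (filter (\<lambda>w. wset w \<inter> D \<noteq> {}) ws2)"
            by (rule IH) (use prems(1-4,6-8) cA Cons Cons1 ws2 succ2 ab in auto)
          then obtain zs where zs: "pth c zs" "zs \<noteq> []" "hd zs = b" "last zs \<in> insert b (A - {a} - {b})"
               "set zs \<subseteq> insert b (A - {a} - {b}) \<union> {x. x \<in> \<Union>(wset ` set ws2) \<and> x \<notin> D \<and> (\<exists>a\<in>Y. adj c a x)}"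
               "2 * length ws2 \<le> length zs + 1 + 4 * length (filter (\<lambda>w. wset w \<inter> D \<noteq> {}) ws2)"
            by blast
          have off: "wset w' \<inter> Y = {}" if "w' \<in> set ws" for w'
            using prems(7) that .
          have xY: "x \<notin> Y" "v \<notin> Y" "x \<noteq> v"
            using off[of w] off[of w2] Cons Cons1 x v ws1(2)[of w2] by auto
          have w2: "w2 \<in> set ws1" "set ws2 \<subseteq> set ws1" "set ws2 \<subseteq> set ws"
            using Cons Cons1 by auto
          have "x \<notin> \<Union>(wset ` set ws2)" "v \<notin> \<Union>(wset ` set ws2)"
            using ws2(2) x(1) v(1) ws1(2) w2 by blast+
          moreover have "b \<in> Y"
            using ab prems(3) by blast
          ultimately have "x \<notin> set zs" "v \<notin> set zs"
            using zs(5) xY prems(3) by blast+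
          moreover have "y \<notin> \<Union>(wset ` set ws2)" "a \<notin> \<Union>(wset ` set ws2)"
            using off w2(3) prems(2) aY by blast+
          then have "y \<notin> set zs" "a \<notin> set zs"
            using zs(5) prems(4) ab by blast+
          ultimately have "pth c (y # x # a # v # zs)"
            using zs x v xY aY ab prems(2) adj_sym by (auto simp: pth_Cons)
          then show ?thesis
            by (intro exI[of _ "y # x # a # v # zs"])
              (use zs Cons Cons1 x v ab True fail(1) prems(2) aY in auto)
        qed
      qed
    qed
  qed
qed

text \<open>List the vertices component by component. Vertices whose positions differ by at least \<open>h - 1\<close>
  then lie in different components, so \<open>t\<^sub>0, t\<^sub>h, t\<^sub>1, t\<^sub>h\<^sub>+\<^sub>1, \<dots>\<close> is a path.\<close>

lemma multipartite_path:
  assumes V: "finite V" "a \<in> V" "v \<in> V" "a \<noteq> v"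
    and small: "\<And>x. x \<in> V \<Longrightarrow> card (comp (\<not> c) V x) + s + 3 \<le> card V"
    and s: "2 * s + 2 \<le> card V" "2 \<le> s"
  shows "\<exists>xs. pth c xs \<and> xs \<noteq> [] \<and> hd xs = a \<and> last xs = v \<and> set xs \<subseteq> V \<and> 2 * s \<le> length xs"
proof -
  \<comment> \<open>A representative of each component; sorting by it turns the components into
    intervals of the list.\<close>
  define key where "key x = Min (comp (\<not> c) V x)" for x
  have fin: "finite (comp (\<not> c) V x)" for x
    by (rule finite_subset[OF comp_subset V(1)])
  have key_eq: "y \<in> comp (\<not> c) V x" if "x \<in> V" "y \<in> V" "key x = key y" for x y
  proof -
    have "key x \<in> comp (\<not> c) V x" "key x \<in> comp (\<not> c) V y"
      using that Min_in[OF fin[of x]] Min_in[OF fin[of y]] comp_self[of x V] comp_self[of y V]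
      by (auto simp: key_def)
    then show ?thesis
      using trans[OF comp_eq[THEN sym] comp_eq] comp_self[OF that(2), of "\<not> c"] by blast
  qed
  have key_adj: "adj c x y" if "x \<in> V" "y \<in> V" "key x \<noteq> key y" for x y
  proof (rule ccontr)
    assume "\<not> adj c x y"
    then have "adj (\<not> c) x y"
      using that(3) adj_total[of x y c] by auto
    then have "y \<in> comp (\<not> c) V x"
      using that comp_closed[OF comp_self[OF that(1)]] by simp
    then show False
      using that(3) comp_eq unfolding key_def by metis
  qed
  define L where "L = sort_key key (sorted_list_of_set (V - {a, v}))"
  define m where "m = length L"
  have m: "m = card V - 2"
    using V by (simp add: m_def L_def card_Diff_subset)
  have L: "distinct L" "set L = V - {a, v}" "sorted (map key L)"
    using V by (auto simp: L_def)
  \<comment> \<open>By \<open>small\<close> and \<open>m = card V - 2\<close>, a component has at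
    most \<open>h - 1\<close> vertices, so \<open>h\<close> consecutive positions never lie in one
    component. Consecutive vertices of \<open>ts\<close> are \<open>h\<close> or
    \<open>h - 1\<close> positions apart.\<close>
  define h where "h = m - s"
  have h: "s \<le> h" "s + h = m" "2 \<le> h"
    using s m by (auto simp: h_def)
  have Lin: "L ! i \<in> V" "L ! i \<noteq> a" "L ! i \<noteq> v" if "i < m" for i
    using that L(2) nth_mem[of i L] by (auto simp: m_def)
  have far: "key (L ! i) \<noteq> key (L ! j)" if "i < j" "j < m" "h \<le> j - i + 1" for i j
  proof
    assume eq: "key (L ! i) = key (L ! j)"
    have "L ! k \<in> comp (\<not> c) V (L ! i)" if "k \<in> {i..j}" for k
    proof -
      have "key (L ! i) \<le> key (L ! k)" "key (L ! k) \<le> key (L ! j)"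
        using that \<open>j < m\<close> sorted_nth_mono[OF L(3), of i k] sorted_nth_mono[OF L(3), of k j]
        by (auto simp: m_def)
      then show ?thesis
        using eq that \<open>j < m\<close> Lin by (intro key_eq) auto
    qed
    then have "(!) L ` {i..j} \<subseteq> comp (\<not> c) V (L ! i)"
      by blast
    moreover have "inj_on ((!) L) {i..j}"
      using L(1) \<open>j < m\<close> by (auto simp: inj_on_def m_def nth_eq_iff_index_eq)
    ultimately have "card {i..j} \<le> card (comp (\<not> c) V (L ! i))"
      by (metis card_image card_mono fin)
    moreover have "card (comp (\<not> c) V (L ! i)) + s + 3 \<le> card V"
      using small Lin that by simp
    ultimately show False
      using that m h by auto
  qed
  define p where "p k = (if even k then k div 2 else h + k div 2)" for k :: nat
  have p: "p k < m" if "k < 2 * s" for k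
    using that h by (auto simp: p_def)
  have p_inj: "k = l" if "p k = p l" "k < 2 * s" "l < 2 * s" for k l
    using that h by (auto simp: p_def elim!: evenE oddE split: if_splits)
  define ts where "ts = map (\<lambda>k. L ! p k) [0..<2 * s]"
  have ts_key: "key (ts ! k) \<noteq> key (ts ! Suc k)" if "Suc k < 2 * s" for k
  proof (cases "even k")
    case True
    then show ?thesis
      using far[of "p k" "p (Suc k)"] p[of "Suc k"] that h by (auto simp: ts_def p_def elim!: evenE)
  next
    case False
    then show ?thesis
      using far[of "p (Suc k)" "p k"] p[of k] that h by (auto simp: ts_def p_def elim!: oddE)
  qed
  have ts_len: "length ts = 2 * s"
    by (simp add: ts_def)
  have ts_in: "set ts \<subseteq> V - {a, v}"
    using Lin[OF p] by (force simp: ts_def)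
  have tsV: "ts ! k \<in> V" if "k < 2 * s" for k
    using that ts_in nth_mem[of k ts] unfolding ts_len by auto
  have "distinct ts"
    unfolding ts_def distinct_map
  proof
    show "inj_on (\<lambda>k. L ! p k) (set [0..<2 * s])"
    proof (rule inj_onI)
      fix k l
      assume "k \<in> set [0..<2 * s]" "l \<in> set [0..<2 * s]" "L ! p k = L ! p l"
      then show "k = l"
        using p_inj[of k l] p[of k] p[of l] nth_eq_iff_index_eq[OF L(1)] by (simp add: m_def)
    qed
  qed simp
  moreover have "successively (adj c) ts"
    unfolding successively_conv_nth using ts_key ts_len key_adj tsV by auto
  ultimately have ts: "pth c ts"
    by (simp add: pth_def)
  \<comment> \<open>Neighbours on \<open>ts\<close> lie in different components, so \<open>a\<close>
    is joined to one of the first two vertices and \<open>v\<close> to one of the last two. At most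
    one vertex is dropped at either end, and \<open>a\<close> and \<open>v\<close> make up for
    it.\<close>
  have "key a \<noteq> key (ts ! 0) \<or> key a \<noteq> key (ts ! 1)"
    using ts_key[of 0] s by auto
  then obtain i where i: "i \<le> 1" "adj c a (ts ! i)"
  proof
    assume "key a \<noteq> key (ts ! 0)"
    then show thesis
      using that[of 0] key_adj[OF V(2)] tsV[of 0] s by auto
  next
    assume "key a \<noteq> key (ts ! 1)"
    then show thesis
      using that[of 1] key_adj[OF V(2)] tsV[of 1] s by auto
  qed
  have "key v \<noteq> key (ts ! (2 * s - 1)) \<or> key v \<noteq> key (ts ! (2 * s - 2))"
    using ts_key[of "2 * s - 2"] s by (auto simp: Suc_diff_Suc numeral_2_eq_2)
  then obtain j where j: "2 * s - 2 \<le> j" "j < 2 * s" "adj c v (ts ! j)"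
  proof
    assume "key v \<noteq> key (ts ! (2 * s - 1))"
    then show thesis
      using that[of "2 * s - 1"] key_adj[OF V(3)] tsV[of "2 * s - 1"] s by auto
  next
    assume "key v \<noteq> key (ts ! (2 * s - 2))"
    then show thesis
      using that[of "2 * s - 2"] key_adj[OF V(3)] tsV[of "2 * s - 2"] s by auto
  qed
  define us where "us = drop i (take (Suc j) ts)"
  have us: "pth c us"
    unfolding us_def using ts pth_take pth_drop by blast
  have us_len: "length us = Suc j - i" "2 \<le> length us"
    using i j s ts_len by (auto simp: us_def)
  then have us0: "us \<noteq> []"
    by auto
  have us_hd: "hd us = ts ! i"
    unfolding us_def using i j s ts_len by (subst hd_drop_conv_nth) auto
  have us_last: "last us = ts ! j"
    unfolding us_def using i j s ts_len by (subst last_drop) (auto simp: take_Suc_conv_app_nth)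
  have us_in: "set us \<subseteq> V - {a, v}"
    unfolding us_def using ts_in set_drop_subset set_take_subset by fastforce
  have "pth c (a # us @ [v])"
    using us us0 us_hd us_last us_in i j V(4) adj_sym by (auto simp: pth_Cons pth_append)
  then show ?thesis
    using us_len us_in V i j by (intro exI[of _ "a # us @ [v]"]) auto
qed

end

lemma set_butlast_last: "z \<in> set xs \<Longrightarrow> z = last xs \<or> z \<in> set (butlast xs)"
  by (cases xs rule: rev_cases) auto

lemma deleted_windows:
  assumes "finite D" "sorted_wrt (\<lambda>w w'. wset w \<inter> wset w' = {}) ws"
  shows "length (filter (\<lambda>w. wset w \<inter> D \<noteq> {}) ws) \<le> card D"
  using assms
proof (induction ws arbitrary: D)
  case (Cons w ws)
  \<comment> \<open>\<open>w'\<close> is a second name for \<open>w\<close>, which is hidden by the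
    bound variable of the filter.\<close>
  have "filter (\<lambda>w. wset w \<inter> D \<noteq> {}) ws = filter (\<lambda>w. wset w \<inter> (D - wset w') \<noteq> {}) ws" if "w' = w" for w'
    using Cons.prems(2) that by (intro filter_cong) auto
  then have eq: "length (filter (\<lambda>w. wset w \<inter> D \<noteq> {}) ws) \<le> card (D - wset w)"
    using Cons.IH[of "D - wset w"] Cons.prems by simp
  show ?case
  proof (cases "wset w \<inter> D = {}")
    case True
    then have "D - wset w = D"
      by blast
    then show ?thesis
      using True eq by simp
  next
    case False
    then have "card (D - wset w) < card D"
      using Cons.prems(1) by (intro psubset_card_mono) auto
    then show ?thesis
      using False eq by simp
  qed
qed simp

section \<open>Joining a shortest path, an inner path and a zigzag\<close>

context edge_colouring
begin

text \<open>Cutting \<open>ws\<close> into pairs of consecutive windows gives disjoint blocks, each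
  of which contains a common neighbour.\<close>

lemma common_neighbours:
  assumes "a \<in> Y" "b \<in> Y" "a \<noteq> b" "2 * q \<le> length ws"
    and "sorted_wrt (\<lambda>w w'. wset w \<inter> wset w' = {}) ws"
    and "successively (\<lambda>w w'. \<forall>a\<in>Y. \<forall>b\<in>Y. a \<noteq> b \<longrightarrow> (\<exists>x\<in>wset w \<union> wset w'. adj c a x \<and> adj c b x)) ws"
  shows "\<exists>X. finite X \<and> card X = q \<and> X \<subseteq> \<Union>(wset ` set ws) \<and> (\<forall>x\<in>X. adj c a x \<and> adj c b x)"
  using assms(4-)
proof (induction q arbitrary: ws)
  case 0
  show ?case
    by (intro exI[of _ "{}"]) auto
next
  case (Suc q)
  obtain w w' vs where ws: "ws = w # w' # vs"
    using Suc.prems(1) by (cases ws rule: remdups_adj.cases) auto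
  have "successively (\<lambda>w w'. \<forall>a\<in>Y. \<forall>b\<in>Y. a \<noteq> b \<longrightarrow> (\<exists>x\<in>wset w \<union> wset w'. adj c a x \<and> adj c b x)) vs"
    using Suc.prems(3) ws by (auto simp: successively_Cons)
  then obtain X where X: "finite X" "card X = q" "X \<subseteq> \<Union>(wset ` set vs)" "\<forall>x\<in>X. adj c a x \<and> adj c b x"
    using Suc.IH[of vs] Suc.prems ws by auto
  obtain x where x: "x \<in> wset w \<union> wset w'" "adj c a x \<and> adj c b x"
    using Suc.prems(3) ws assms(1-3) by auto
  have "x \<notin> X"
    using X(3) x(1) Suc.prems(2) ws by fastforce
  then show ?case
    using X x ws by (intro exI[of _ "insert x X"]) auto
qed

lemma common_neighbour_avoiding:
  assumes "a \<in> Y" "b \<in> Y" "a \<noteq> b" "2 * Suc (card D) \<le> length ws" "finite D"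
    and "sorted_wrt (\<lambda>w w'. wset w \<inter> wset w' = {}) ws"
    and "successively (\<lambda>w w'. \<forall>a\<in>Y. \<forall>b\<in>Y. a \<noteq> b \<longrightarrow> (\<exists>x\<in>wset w \<union> wset w'. adj c a x \<and> adj c b x)) ws"
  shows "\<exists>x. x \<in> \<Union>(wset ` set ws) \<and> x \<notin> D \<and> adj c a x \<and> adj c b x"
proof -
  obtain X where X: "finite X" "card X = Suc (card D)" "X \<subseteq> \<Union>(wset ` set ws)"
    "\<forall>x\<in>X. adj c a x \<and> adj c b x"
    using common_neighbours[OF assms(1-4,6,7)] by blast
  then have "\<not> X \<subseteq> D"
    using card_mono[OF assms(5), of X] by auto
  then show ?thesis
    using X by blast
qed

text \<open>
  The path runs along a shortest path from \<open>f\<close> to \<open>Y\<close>, through the given path in \<open>Y\<close>, and backwards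
  along a zigzag which starts next to the exit \<open>v\<close>. Apart from its last two vertices the shortest path
  is not adjacent to \<open>Y\<close>, so it meets no window vertex that the zigzag can use.
\<close>

lemma long_path:
  assumes finY: "finite Y" and Y: "Y \<subseteq> W"
    and meet: "y0 \<in> comp c W f" "y0 \<in> Y"
    and disj: "sorted_wrt (\<lambda>w w'. wset w \<inter> wset w' = {}) ws"
    and off: "\<And>w. w \<in> set ws \<Longrightarrow> wset w \<inter> Y = {}"
    and cover: "\<And>w a. w \<in> set ws \<Longrightarrow> a \<in> Y \<Longrightarrow> \<exists>x\<in>wset w. adj c a x"
    and common: "successively (\<lambda>w w'. \<forall>a\<in>Y. \<forall>b\<in>Y. a \<noteq> b \<longrightarrow> (\<exists>x\<in>wset w \<union> wset w'. adj c a x \<and> adj c b x)) ws"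
    and outside: "finite F" "\<Union>(wset ` set ws) - W \<subseteq> F" "card F \<le> d"
    and inner: "\<And>y. y \<in> Y \<Longrightarrow> \<exists>zs. pth c zs \<and> set zs \<subseteq> Y - {y} \<and> length zs = K" and K: "1 \<le> K"
    and exits: "\<And>D. finite D \<Longrightarrow> card D \<le> K + 2 \<Longrightarrow>
      \<exists>v\<in>E. v \<in> W \<and> v \<notin> D \<and> (\<exists>w\<in>Y - D. v = w \<or> v \<notin> Y \<and> adj c v w)"
    and size: "length ws + K + 2 \<le> card Y" "2 * (d + 4) \<le> length ws"
  shows "\<exists>xs. pth c xs \<and> xs \<noteq> [] \<and> hd xs = f \<and> last xs \<in> E \<and> set xs \<subseteq> W \<and>
           2 * length ws + K \<le> length xs + (8 * d + 22)"
proof -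
  obtain ls where ls: "pth c ls" "ls \<noteq> []" "hd ls = f" "last ls \<in> Y" "set ls \<subseteq> W"
    "set (butlast ls) \<inter> Y = {}"
    "\<And>l z. l \<in> set (butlast (butlast ls)) \<Longrightarrow> z \<in> Y \<Longrightarrow> z \<in> W \<Longrightarrow> \<not> adj c l z"
    using shortest_path_to_set[OF meet] by blast
  define y1 where "y1 = last ls"
  \<comment> \<open>The only vertex of \<open>ls\<close> off \<open>Y\<close> that may have
    neighbours in \<open>Y\<close>. If \<open>ls\<close> has one vertex, this is the unspecified
    \<open>last []\<close>, whose exclusion costs at most one vertex.\<close>
  define l1 where "l1 = last (butlast ls)"
  have ls_split: "z = y1 \<or> z = l1 \<or> z \<in> set (butlast (butlast ls))" if "z \<in> set ls" for z
    using set_butlast_last[OF that] set_butlast_last[of z "butlast ls"] by (auto simp: y1_def l1_def)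
  have ls_adj: "z \<notin> set ls" if "z \<notin> Y" "z \<noteq> l1" "a \<in> Y" "adj c a z" for z a
    using ls_split[of z] that ls(4) ls(7)[of z a] Y adj_sym by (auto simp: y1_def)
  have ls_Y: "z = y1" if "z \<in> set ls" "z \<in> Y" for z
    using set_butlast_last[OF that(1)] that(2) ls(6) by (auto simp: y1_def)
  have y1: "y1 \<in> Y"
    using ls(4) by (simp add: y1_def)
  \<comment> \<open>The entry \<open>y1\<close> is known only now; this is why \<open>inner\<close>
    allows any vertex of \<open>Y\<close> to be left out.\<close>
  obtain zs where zs: "pth c zs" "set zs \<subseteq> Y - {y1}" "length zs = K"
    using inner[OF y1] by blast
  have zs0: "zs \<noteq> []"
    using zs(3) K by auto
  define D where "D = insert y1 (insert l1 (set zs))"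
  have "card (set zs) = K"
    using zs pth_length by metis
  then have "card D \<le> K + 2"
    by (simp add: D_def card_insert_if)
  then obtain v w where v: "v \<in> E" "v \<in> W" "v \<notin> D" "w \<in> Y" "w \<notin> D" "v = w \<or> v \<notin> Y \<and> adj c v w"
    using exits[of D] by (auto simp: D_def)
  define D2 where "D2 = insert v (insert l1 F)"
  have D2: "finite D2" "card D2 \<le> d + 2"
    using outside by (auto simp: D2_def card_insert_if)
  have DW: "x \<in> W" if "x \<in> \<Union>(wset ` set ws)" "x \<notin> D2" for x
    using outside that by (auto simp: D2_def)
  define A where "A = Y - {y1, w} - set zs"
  \<comment> \<open>The last \<open>2 * (d + 4)\<close> windows are reserved for the connecting
    vertices \<open>u1\<close> and \<open>u2\<close>: \<open>D2\<close> and \<open>u1\<close> make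
    up to \<open>d + 3\<close> vertices to be avoided, and a common neighbour off them needs
    \<open>2 * Suc (d + 3)\<close> windows.\<close>
  define r where "r = length ws - 2 * (d + 4)"
  define ws1 where "ws1 = take r ws"
  define ws2 where "ws2 = drop r ws"
  have ws12: "ws = ws1 @ ws2"
    by (simp add: ws1_def ws2_def)
  have len: "length ws1 = r" "length ws2 = 2 * (d + 4)" "length ws = r + 2 * (d + 4)"
    using size by (auto simp: ws1_def ws2_def r_def)
  have disj12: "sorted_wrt (\<lambda>w w'. wset w \<inter> wset w' = {}) ws1"
    "sorted_wrt (\<lambda>w w'. wset w \<inter> wset w' = {}) ws2"
    "\<And>w w'. w \<in> set ws1 \<Longrightarrow> w' \<in> set ws2 \<Longrightarrow> wset w \<inter> wset w' = {}"
    using disj unfolding ws12 by (auto simp: sorted_wrt_append)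
  have common12: "successively (\<lambda>w w'. \<forall>a\<in>Y. \<forall>b\<in>Y. a \<noteq> b \<longrightarrow> (\<exists>x\<in>wset w \<union> wset w'. adj c a x \<and> adj c b x)) ws1"
    "successively (\<lambda>w w'. \<forall>a\<in>Y. \<forall>b\<in>Y. a \<noteq> b \<longrightarrow> (\<exists>x\<in>wset w \<union> wset w'. adj c a x \<and> adj c b x)) ws2"
    using common unfolding ws12 by (auto simp: successively_append_iff)
  have sub12: "set ws1 \<subseteq> set ws" "set ws2 \<subseteq> set ws"
    unfolding ws12 by auto
  have cA: "length ws1 \<le> card A"
  proof -
    have "card A \<ge> card Y - card {y1, w} - card (set zs)"
      using diff_card_le_card_Diff[of "{y1, w}" Y] diff_card_le_card_Diff[of "set zs" "Y - {y1, w}"]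
      by (simp add: A_def)
    then show ?thesis
      using size len \<open>card (set zs) = K\<close> card_insert_if[of "{w}" y1] by (auto split: if_splits)
  qed
  have "\<exists>zg. pth c zg \<and> zg \<noteq> [] \<and> hd zg = w \<and> last zg \<in> insert w A \<and>
           set zg \<subseteq> insert w A \<union> {x. x \<in> \<Union>(wset ` set ws1) \<and> x \<notin> D2 \<and> (\<exists>a\<in>Y. adj c a x)} \<and>
           2 * length ws1 \<le> length zg + 1 + 4 * length (filter (\<lambda>w. wset w \<inter> D2 \<noteq> {}) ws1)"
  proof (rule zigzag)
    show "successively (\<lambda>w w'. wset w \<inter> D2 = {} \<longrightarrow> wset w' \<inter> D2 = {} \<longrightarrow>
           (\<forall>a\<in>Y. \<forall>b\<in>Y. a \<noteq> b \<longrightarrow> (\<exists>x\<in>wset w \<union> wset w'. adj c a x \<and> adj c b x))) ws1"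
      using common12(1) by (rule successively_mono) auto
    show "\<exists>x\<in>wset w. adj c a x" if "w \<in> set ws1" "a \<in> Y" for w a
      using cover that sub12 by blast
    show "wset w \<inter> Y = {}" if "w \<in> set ws1" for w
      using off that sub12 by blast
  qed (use finY v cA disj12 in \<open>auto simp: A_def\<close>)
  then obtain zg where zg: "pth c zg" "zg \<noteq> []" "hd zg = w" "last zg \<in> insert w A"
    "set zg \<subseteq> insert w A \<union> {x. x \<in> \<Union>(wset ` set ws1) \<and> x \<notin> D2 \<and> (\<exists>a\<in>Y. adj c a x)}"
    "2 * length ws1 \<le> length zg + 1 + 4 * length (filter (\<lambda>w. wset w \<inter> D2 \<noteq> {}) ws1)"
    by blast
  have "length (filter (\<lambda>w. wset w \<inter> D2 \<noteq> {}) ws1) \<le> d + 2"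
    using deleted_windows[OF D2(1) disj12(1)] D2(2) by simp
  then have zg_len: "2 * r \<le> length zg + 4 * d + 9"
    using zg(6) len by simp
  have zsY: "hd zs \<in> Y" "last zs \<in> Y" "y1 \<noteq> hd zs"
    using zs(2) hd_in_set[OF zs0] last_in_set[OF zs0] by auto
  have "2 * Suc (card D2) \<le> length ws2"
    using D2 len by simp
  then obtain u1 where u1: "u1 \<in> \<Union>(wset ` set ws2)" "u1 \<notin> D2" "adj c y1 u1" "adj c (hd zs) u1"
    using common_neighbour_avoiding[OF y1 zsY(1,3) _ D2(1) disj12(2) common12(2)] by blast
  have zgY: "last zg \<in> Y" "last zg \<notin> set zs"
    using zg(4) v by (auto simp: A_def D_def)
  then have ne: "last zs \<noteq> last zg"
    using last_in_set[OF zs0] by auto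
  have "2 * Suc (card (insert u1 D2)) \<le> length ws2"
    using D2 len u1(2) by simp
  then obtain u2 where u2: "u2 \<in> \<Union>(wset ` set ws2)" "u2 \<notin> D2" "u2 \<noteq> u1" "adj c (last zs) u2" "adj c (last zg) u2"
    using common_neighbour_avoiding[OF zsY(2) zgY(1) ne, of "insert u1 D2"] D2(1) disj12(2) common12(2) by blast
  have uY: "u1 \<notin> Y" "u2 \<notin> Y" "u1 \<notin> \<Union>(wset ` set ws1)" "u2 \<notin> \<Union>(wset ` set ws1)"
    using u1(1) u2(1) off sub12(2) disj12(3) by blast+
  have ul: "u1 \<notin> set ls" "u2 \<notin> set ls"
    using ls_adj[OF uY(1) _ y1 u1(3)] ls_adj[OF uY(2) _ zgY(1) u2(5)] u1(2) u2(2) by (auto simp: D2_def)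
  have uz: "u1 \<notin> set zs" "u2 \<notin> set zs"
    using uY zs(2) by auto
  have AY: "insert w A \<subseteq> Y"
    using v by (auto simp: A_def)
  have ug: "u1 \<notin> set zg" "u2 \<notin> set zg"
    using zg(5) AY uY by blast+
  have wsY1: "x \<notin> Y" if "x \<in> \<Union>(wset ` set ws1)" for x
    using that off sub12 by blast
  have lz: "set ls \<inter> set zs = {}"
    using ls_Y zs(2) by blast
  have gz: "set zg \<inter> set zs = {}"
  proof -
    have "insert w A \<inter> set zs = {}"
      using v by (auto simp: A_def D_def)
    then show ?thesis
      using zg(5) wsY1 zs(2) by blast
  qed
  have lg: "set ls \<inter> set zg = {}"
  proof -
    have 1: "x \<notin> set ls" if "x \<in> insert w A" for x
      using ls_Y[of x] AY that v by (auto simp: A_def D_def)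
    have 2: "x \<notin> set ls" if "x \<in> \<Union>(wset ` set ws1)" "x \<notin> D2" "a \<in> Y" "adj c a x" for x a
      using ls_adj[OF wsY1[OF that(1)] _ that(3,4)] that(2) by (auto simp: D2_def)
    have "x \<notin> set ls" if x: "x \<in> set zg" for x
    proof (cases "x \<in> insert w A")
      case False
      then have "x \<in> {x. x \<in> \<Union>(wset ` set ws1) \<and> x \<notin> D2 \<and> (\<exists>a\<in>Y. adj c a x)}"
        using subsetD[OF zg(5) x] by simp
      then show ?thesis
        using 2 by blast
    qed (rule 1)
    then show ?thesis
      by blast
  qed
  define xs where "xs = ls @ [u1] @ zs @ [u2] @ rev zg"
  have "pth c (u2 # rev zg)"
    using zg(1,2) ug(2) adj_sym[OF u2(5)] by (simp add: pth_Cons hd_rev)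
  then have "pth c (zs @ u2 # rev zg)"
    using zs(1) uz(2) gz u2(4) by (auto simp: pth_append)
  then have "pth c (u1 # zs @ u2 # rev zg)"
    using uz(1) ug(1) u2(3) zs0 adj_sym[OF u1(4)] by (simp add: pth_Cons)
  then have xs: "pth c xs"
    unfolding xs_def using ls(1) ul lz lg u1(3) by (auto simp: pth_append y1_def)
  have xs_W: "set xs \<subseteq> W"
  proof -
    have "set zg \<subseteq> W"
      using zg(5) AY Y DW sub12(1) by blast
    moreover have "u1 \<in> W" "u2 \<in> W"
      using DW u1 u2 sub12(2) by blast+
    ultimately show ?thesis
      using ls(5) zs(2) Y by (auto simp: xs_def)
  qed
  have xs_hd: "xs \<noteq> []" "hd xs = f" "last xs = w"
    using ls(2,3) zg(2,3) by (auto simp: xs_def last_rev)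
  \<comment> \<open>The zigzag loses \<open>4 * d + 9\<close>, the reserved windows
    \<open>4 * d + 16\<close>; at least three vertices are regained from \<open>ls\<close>,
    \<open>u1\<close> and \<open>u2\<close>.\<close>
  have xs_len: "2 * length ws + K \<le> length xs + (8 * d + 22)"
    using zg_len len zs(3) ls(2) length_greater_0_conv[of ls] by (simp add: xs_def del: length_greater_0_conv)
  show ?thesis
  proof (cases "v = w")
    case True
    then show ?thesis
      using xs xs_W xs_hd xs_len v by blast
  next
    case False
    then have vY: "v \<notin> Y" "adj c v w"
      using v by auto
    have "v \<notin> set ls"
      using ls_adj[OF vY(1) _ v(4)] vY(2) v(3) adj_sym by (auto simp: D_def)
    moreover have "v \<notin> set zs" "v \<noteq> u1" "v \<noteq> u2"
      using v(3) u1(2) u2(2) by (auto simp: D_def D2_def)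
    moreover have "v \<notin> set zg"
      using zg(5) AY vY(1) by (auto simp: D2_def)
    ultimately have "v \<notin> set xs"
      by (auto simp: xs_def)
    then have "pth c (xs @ [v])"
      using xs xs_hd vY(2) adj_sym by (auto simp: pth_append)
    then show ?thesis
      using xs_W xs_hd xs_len v by (intro exI[of _ "xs @ [v]"]) auto
  qed
qed

text \<open>\<open>R\<close> replaces the segment strictly between the positions \<open>i\<close>
  and \<open>j\<close>. It has to avoid the parts that are kept, but may reuse vertices of that
  segment, as \<open>no_alternation\<close> does.\<close>

lemma insert_path:
  assumes "pth c xs" "i < j" "j < length xs" "pth c R" "R \<noteq> []"
    and "adj c (xs ! i) (hd R)" "adj c (last R) (xs ! j)"
    and "set R \<inter> set (take (Suc i) xs) = {}" "set R \<inter> set (drop j xs) = {}"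
  shows "\<exists>xs'. pth c xs' \<and> xs' \<noteq> [] \<and> hd xs' = hd xs \<and> last xs' = last xs \<and>
           set xs' \<subseteq> set xs \<union> set R \<and> length xs' + j = length xs + length R + Suc i"
proof -
  define xs' where "xs' = take (Suc i) xs @ R @ drop j xs"
  have "set (take (Suc i) xs) \<inter> set (drop j xs) = {}"
    using pth_distinct[OF assms(1)] assms(2) by (intro set_take_disj_set_drop_if_distinct) auto
  moreover have "last (take (Suc i) xs) = xs ! i" "hd (drop j xs) = xs ! j"
    using assms by (auto simp: take_Suc_conv_app_nth hd_drop_conv_nth)
  ultimately have "pth c xs'"
    unfolding xs'_def pth_append using assms pth_take pth_drop by auto
  moreover have "set xs' \<subseteq> set xs \<union> set R"
    unfolding xs'_def using set_take_subset set_drop_subset by fastforce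
  moreover have "hd xs' = hd xs" "xs' \<noteq> []"
    using assms by (auto simp: xs'_def hd_append)
  moreover have "last xs' = last xs"
    using assms by (auto simp: xs'_def)
  moreover have "length xs' + j = length xs + length R + Suc i"
    using assms by (simp add: xs'_def)
  ultimately show ?thesis
    by blast
qed

text \<open>Successive vertices of \<open>ss\<close> are linked by fresh common neighbours in
  \<open>T\<close>. The forbidden set \<open>B\<close> consists of \<open>ss\<close> and the path
  built so far, less than \<open>3 * length ss\<close> vertices in all.\<close>

lemma greedy_path:
  assumes "distinct ss" "ss \<noteq> []"
    and "\<And>x y B. x \<in> set ss \<Longrightarrow> y \<in> set ss \<Longrightarrow> x \<noteq> y \<Longrightarrow> finite B \<Longrightarrow> card B < 3 * length ss \<Longrightarrow>
      set ss \<subseteq> B \<Longrightarrow> \<exists>z\<in>T. z \<notin> B \<and> adj c x z \<and> adj c y z"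
  shows "\<exists>zs. pth c zs \<and> zs \<noteq> [] \<and> set zs \<subseteq> set ss \<union> T \<and> length ss \<le> length zs"
proof -
  have "\<exists>zs. pth c zs \<and> zs \<noteq> [] \<and> hd zs = hd us \<and> set zs \<subseteq> set us \<union> (T - set ss) \<and> length zs = 2 * length us - 1"
    if "us \<noteq> []" "distinct us" "set us \<subseteq> set ss" for us
    using that
  proof (induction us)
    case (Cons x us)
    show ?case
    proof (cases "us = []")
      case True
      then show ?thesis
        by (intro exI[of _ "[x]"]) auto
    next
      case False
      then obtain zs where zs: "pth c zs" "zs \<noteq> []" "hd zs = hd us" "set zs \<subseteq> set us \<union> (T - set ss)"
        "length zs = 2 * length us - 1"
        using Cons by auto
      have us: "hd us \<in> set us"
        using False by simp
      have "length (x # us) \<le> length ss"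
        using Cons.prems(2,3) assms(1) by (metis List.finite_set card_mono distinct_card)
      moreover have "card (set zs \<union> set ss) \<le> length zs + length ss"
        by (metis List.finite_set add_mono card_Un_le card_length le_trans)
      ultimately have "card (set zs \<union> set ss) < 3 * length ss"
        using zs(5) by simp
      then obtain z where z: "z \<in> T" "z \<notin> set zs \<union> set ss" "adj c x z" "adj c (hd us) z"
        using assms(3)[of x "hd us" "set zs \<union> set ss"] Cons.prems us by auto
      have "x \<notin> set zs" "x \<noteq> z"
        using Cons.prems zs(4) z by auto
      then have "pth c (x # z # zs)"
        using zs(1,2,3) z adj_sym by (auto simp: pth_Cons)
      then show ?thesis
        using z zs False by (intro exI[of _ "x # z # zs"]) (auto simp: neq_Nil_conv)
    qed
  qed simp
  from this[of ss] obtain zs where zs: "pth c zs" "zs \<noteq> []" "set zs \<subseteq> set ss \<union> (T - set ss)"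
      "length zs = 2 * length ss - 1"
    using assms(1,2) by blast
  moreover have "length ss \<le> 2 * length ss - 1"
    using assms(2) by (cases ss) auto
  ultimately show ?thesis
    by auto
qed

end

section \<open>Dense colour classes and giant components\<close>

context edge_colouring
begin

text \<open>Otherwise \<open>A\<close> and \<open>B\<close> are completely joined in colour
  \<open>\<not> c\<close>, and \<open>greedy_path\<close> winds through \<open>K\<close> vertices of
  \<open>A\<close>. The set \<open>B\<close> has three times as many, so a fresh vertex is always
  left.\<close>

lemma edge_between:
  assumes no: "\<And>zs. pth (\<not> c) zs \<Longrightarrow> set zs \<subseteq> Y \<Longrightarrow> length zs < K"
    and "1 \<le> K" "A \<subseteq> Y" "B \<subseteq> Y" "finite A" "finite B" "A \<inter> B = {}" "K \<le> card A" "3 * K \<le> card B"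
  shows "\<exists>a\<in>A. \<exists>b\<in>B. adj c a b"
proof (rule ccontr)
  assume contra: "\<not> ?thesis"
  obtain S where S: "S \<subseteq> A" "card S = K" "finite S"
    using obtain_subset_with_card_n[OF assms(8)] by blast
  define ss where "ss = sorted_list_of_set S"
  have ss: "distinct ss" "set ss = S" "length ss = K"
    using S by (auto simp: ss_def)
  have "\<exists>zs. pth (\<not> c) zs \<and> zs \<noteq> [] \<and> set zs \<subseteq> set ss \<union> B \<and> length ss \<le> length zs"
  proof (rule greedy_path)
    show "distinct ss" "ss \<noteq> []"
      using ss assms(2) by auto
    fix x y :: nat and B' :: "nat set"
    assume xy: "x \<in> set ss" "y \<in> set ss" "finite B'" "card B' < 3 * length ss"
    then have "\<not> B \<subseteq> B'"
      using assms(9) ss card_mono[of B' B] by auto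
    then obtain z where z: "z \<in> B" "z \<notin> B'"
      by blast
    have "x \<in> A" "y \<in> A"
      using xy ss S by auto
    then have "adj (\<not> c) x z" "adj (\<not> c) y z"
      using contra z assms(7) adj_total[of x z c] adj_total[of y z c] by blast+
    then show "\<exists>z\<in>B. z \<notin> B' \<and> adj (\<not> c) x z \<and> adj (\<not> c) y z"
      using z by blast
  qed
  then obtain zs where "pth (\<not> c) zs" "set zs \<subseteq> set ss \<union> B" "K \<le> length zs"
    using ss by auto
  moreover have "set ss \<union> B \<subseteq> Y"
    using ss S assms(3,4) by auto
  ultimately show False
    using no[of zs] by auto
qed

text \<open>Two vertices of low degree have at most \<open>6 * K\<close> neighbours in colour
  \<open>c\<close> together, so they have common neighbours in colour \<open>\<not> c\<close> even
  off another \<open>3 * K\<close> vertices. Hence \<open>K\<close> of them would lie on a forbidden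
  path by \<open>greedy_path\<close>.\<close>

lemma few_low_degree:
  assumes "finite Y" and no: "\<And>zs. pth (\<not> c) zs \<Longrightarrow> set zs \<subseteq> Y \<Longrightarrow> length zs < K"
    and "1 \<le> K" "10 * K + 10 \<le> card Y"
  shows "card {y \<in> Y. card {z \<in> Y. adj c y z} < 3 * K + 1} < K"
proof (rule ccontr)
  define Lo where "Lo = {y \<in> Y. card {z \<in> Y. adj c y z} < 3 * K + 1}"
  assume "\<not> ?thesis"
  then have "K \<le> card Lo"
    by (simp add: Lo_def)
  then obtain S where S: "S \<subseteq> Lo" "card S = K" "finite S"
    by (rule obtain_subset_with_card_n)
  define ss where "ss = sorted_list_of_set S"
  have ss: "distinct ss" "set ss = S" "length ss = K"
    using S by (auto simp: ss_def)
  have "\<exists>zs. pth (\<not> c) zs \<and> zs \<noteq> [] \<and> set zs \<subseteq> set ss \<union> Y \<and> length ss \<le> length zs"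
  proof (rule greedy_path)
    show "distinct ss" "ss \<noteq> []"
      using ss assms(3) by auto
    fix x y :: nat and B' :: "nat set"
    assume xy: "x \<in> set ss" "y \<in> set ss" "finite B'" "card B' < 3 * length ss" "set ss \<subseteq> B'"
    define Z where "Z = {z \<in> Y. adj c x z} \<union> {z \<in> Y. adj c y z} \<union> B'"
    have "card Z \<le> card {z \<in> Y. adj c x z} + card {z \<in> Y. adj c y z} + card B'"
      unfolding Z_def by (meson add_le_mono1 card_Un_le le_trans)
    moreover have "card {z \<in> Y. adj c x z} < 3 * K + 1" "card {z \<in> Y. adj c y z} < 3 * K + 1"
      using xy(1,2) ss S by (auto simp: Lo_def)
    ultimately have "card Z < card Y"
      using xy(4) ss assms(4) by linarith
    moreover have "finite Z"
      using xy(3) assms(1) by (simp add: Z_def)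
    ultimately have "\<not> Y \<subseteq> Z"
      using card_mono[of Z Y] by auto
    then obtain z where z: "z \<in> Y" "z \<notin> Z"
      by blast
    then have "x \<noteq> z" "y \<noteq> z" "\<not> adj c x z" "\<not> adj c y z" "z \<notin> B'"
      using xy by (auto simp: Z_def)
    then show "\<exists>z\<in>Y. z \<notin> B' \<and> adj (\<not> c) x z \<and> adj (\<not> c) y z"
      using z(1) adj_total[of x z c] adj_total[of y z c] by blast
  qed
  then obtain zs where "pth (\<not> c) zs" "set zs \<subseteq> set ss \<union> Y" "K \<le> length zs"
    using ss by auto
  moreover have "set ss \<union> Y \<subseteq> Y"
    using ss S by (auto simp: Lo_def)
  ultimately show False
    using no[of zs] by auto
qed

text \<open>Set \<open>K\<close> neighbours of \<open>y\<close> and \<open>K\<close> other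
  neighbours of \<open>y'\<close> aside and partition the rest into two paths of different colours.
  The one of colour \<open>\<not> c\<close> is short, so the other one covers nearly everything. By
  \<open>edge_between\<close> the reserved sets are joined to its first and last
  \<open>3 * K\<close> vertices; trimming it there costs at most \<open>6 * K\<close>
  vertices.\<close>

lemma nearly_spanning_path:
  assumes "finite Y" and no: "\<And>zs. pth (\<not> c) zs \<Longrightarrow> set zs \<subseteq> Y \<Longrightarrow> length zs < K"
    and K: "1 \<le> K" "9 * K + 2 \<le> card Y"
    and y: "y \<in> Y" "y' \<in> Y" "y \<noteq> y'"
    and deg: "2 * K + 1 \<le> card {z \<in> Y. adj c y z}" "2 * K + 1 \<le> card {z \<in> Y. adj c y' z}"
  shows "\<exists>R. pth c R \<and> R \<noteq> [] \<and> hd R = y \<and> last R = y' \<and> set R \<subseteq> Y \<and> card Y \<le> length R + 9 * K"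
proof -
  have "2 * K \<le> card ({z \<in> Y. adj c y z} - {y'})"
    using deg(1) assms(1) by (auto simp: card_Diff_singleton_if)
  then have "K \<le> card ({z \<in> Y. adj c y z} - {y'})"
    by simp
  then obtain N where N: "N \<subseteq> {z \<in> Y. adj c y z} - {y'}" "card N = K" "finite N"
    by (rule obtain_subset_with_card_n)
  have "card ({z \<in> Y. adj c y' z} - {y} - N) \<ge> 2 * K + 1 - 1 - K"
    using deg(2) diff_card_le_card_Diff[OF N(3), of "{z \<in> Y. adj c y' z} - {y}"] N(2)
    by (auto simp: card_Diff_singleton_if split: if_splits)
  then have "K \<le> card ({z \<in> Y. adj c y' z} - {y} - N)"
    by simp
  then obtain N' where N': "N' \<subseteq> {z \<in> Y. adj c y' z} - {y} - N" "card N' = K" "finite N'"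
    by (rule obtain_subset_with_card_n)
  define A where "A = Y - ({y, y'} \<union> N \<union> N')"
  have "card ({y, y'} \<union> N \<union> N') \<le> 2 * K + 2"
    using card_Un_le[of "{y, y'} \<union> N" N'] card_Un_le[of "{y, y'}" N] N(2) N'(2) y(3) by simp
  then have cA: "card Y \<le> card A + 2 * K + 2"
    using diff_card_le_card_Diff[of "{y, y'} \<union> N \<union> N'" Y] N(3) N'(3) by (simp add: A_def)
  obtain r bs where r: "pth c r" "pth (\<not> c) bs" "set r \<inter> set bs = {}" "set r \<union> set bs = A"
    using two_path_partition[of A c] assms(1) by (auto simp: A_def)
  have "length bs < K"
    by (rule no[OF r(2)]) (use r(4) in \<open>auto simp: A_def\<close>)
  moreover have "card A \<le> length r + length bs"
    using r(4) card_Un_le[of "set r" "set bs"] pth_length[OF r(1)] pth_length[OF r(2)] by simp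
  ultimately have rl: "card Y \<le> length r + 3 * K + 1"
    using cA by simp
  define r1 where "r1 = take (3 * K) r"
  define r2 where "r2 = drop (length r - 3 * K) r"
  have rA: "set r \<subseteq> Y" "set r \<inter> N = {}" "set r \<inter> N' = {}" "y \<notin> set r" "y' \<notin> set r"
    using r(4) by (auto simp: A_def)
  have r12: "set r1 \<subseteq> set r" "set r2 \<subseteq> set r" "card (set r1) = 3 * K" "card (set r2) = 3 * K"
    using pth_length[OF pth_take[OF r(1), of "3 * K"]] pth_length[OF pth_drop[OF r(1), of "length r - 3 * K"]]
      rl K(2) by (auto simp: r1_def r2_def dest: in_set_takeD in_set_dropD)
  have sub: "N \<subseteq> Y" "N' \<subseteq> Y" "set r1 \<subseteq> Y" "set r2 \<subseteq> Y" "N \<inter> set r1 = {}" "N' \<inter> set r2 = {}"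
    using N(1) N'(1) r12 rA by blast+
  have "\<exists>a\<in>N. \<exists>b\<in>set r1. adj c a b"
    by (rule edge_between[where Y = Y, OF no]) (use N r12 sub K in simp_all)
  then obtain n1 a where a: "n1 \<in> N" "a \<in> set r1" "adj c n1 a"
    by blast
  have "\<exists>a\<in>N'. \<exists>b\<in>set r2. adj c a b"
    by (rule edge_between[where Y = Y, OF no]) (use N' r12 sub K in simp_all)
  then obtain n2 b where b: "n2 \<in> N'" "b \<in> set r2" "adj c n2 b"
    by blast
  obtain i where i: "i < 3 * K" "r ! i = a"
    using a(2) rl K(2) by (auto simp: r1_def in_set_conv_nth)
  obtain j where "j < length r2" "r2 ! j = b"
    using b(2) by (auto simp: in_set_conv_nth)
  then obtain j where j: "length r - 3 * K \<le> j" "j < length r" "r ! j = b"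
    using rl K(2) by (intro that[of "length r - 3 * K + j"]) (auto simp: r2_def)
  define us where "us = drop i (take (Suc j) r)"
  have us: "pth c us"
    unfolding us_def using r(1) pth_take pth_drop by blast
  have us_len: "length us = Suc j - i" "us \<noteq> []"
    using i j rl K by (auto simp: us_def)
  have us_hd: "hd us = a"
    unfolding us_def using i j rl K by (subst hd_drop_conv_nth) auto
  have us_last: "last us = b"
    unfolding us_def using i j rl K by (subst last_drop) (auto simp: take_Suc_conv_app_nth)
  have us_in: "set us \<subseteq> set r"
    unfolding us_def by (meson set_drop_subset set_take_subset subset_trans)
  have n12: "n1 \<in> Y" "n2 \<in> Y" "n1 \<noteq> n2" "n1 \<notin> set us" "n2 \<notin> set us" "y \<notin> set us" "y' \<notin> set us"
    "n1 \<noteq> y'" "n2 \<noteq> y" "adj c y n1" "adj c y' n2"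
    using N(1) N'(1) a(1) b(1) us_in rA by blast+
  then have ny: "n1 \<noteq> y" "n2 \<noteq> y'"
    using adj_irrefl by auto
  have "pth c (us @ [n2, y'])"
    using us us_len(2) us_last b(3) n12 ny adj_sym by (auto simp: pth_append pth_Cons)
  then have "pth c (y # n1 # us @ [n2, y'])"
    using us_len(2) us_hd a(3) n12 ny y(3) by (simp add: pth_Cons)
  moreover have "set (y # n1 # us @ [n2, y']) \<subseteq> Y"
    using y n12 us_in rA by auto
  ultimately show ?thesis
    using us_len i j rl by (intro exI[of _ "y # n1 # us @ [n2, y']"]) auto
qed

text \<open>Fewer than \<open>K\<close> vertices of low degree are deleted. Each remaining vertex
  thereby loses fewer than \<open>K\<close> of at least \<open>3 * K + 1\<close> neighbours, which
  leaves the \<open>2 * K + 1\<close> that \<open>nearly_spanning_path\<close> asks for.\<close>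

lemma nearly_spanning_subset:
  assumes "finite Y1" and no: "\<And>zs. pth (\<not> c) zs \<Longrightarrow> set zs \<subseteq> Y1 \<Longrightarrow> length zs < K"
    and K: "1 \<le> K" "10 * K + 10 \<le> card Y1"
  obtains Y2 where "Y2 \<subseteq> Y1" "card Y1 < card Y2 + K"
    "\<And>y y'. y \<in> Y2 \<Longrightarrow> y' \<in> Y2 \<Longrightarrow> y \<noteq> y' \<Longrightarrow>
       \<exists>R. pth c R \<and> R \<noteq> [] \<and> hd R = y \<and> last R = y' \<and> set R \<subseteq> Y2 \<and> card Y2 \<le> length R + 9 * K"
proof -
  define Lo where "Lo = {y \<in> Y1. card {z \<in> Y1. adj c y z} < 3 * K + 1}"
  define Y2 where "Y2 = Y1 - Lo"
  have Lo: "card Lo < K" "Lo \<subseteq> Y1" "finite Lo"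
    using few_low_degree[OF assms(1) no K] assms(1) by (auto simp: Lo_def)
  have c: "card Y1 = card Y2 + card Lo"
    using Lo assms(1) by (simp add: Y2_def card_Diff_subset card_mono)
  have deg: "2 * K + 1 \<le> card {z \<in> Y2. adj c y z}" if "y \<in> Y2" for y
  proof -
    have "3 * K + 1 \<le> card {z \<in> Y1. adj c y z}"
      using that by (auto simp: Y2_def Lo_def)
    moreover have "{z \<in> Y1. adj c y z} \<subseteq> {z \<in> Y2. adj c y z} \<union> Lo"
      by (auto simp: Y2_def)
    then have "card {z \<in> Y1. adj c y z} \<le> card {z \<in> Y2. adj c y z} + card Lo"
      using card_mono[of "{z \<in> Y2. adj c y z} \<union> Lo"] card_Un_le[of "{z \<in> Y2. adj c y z}" Lo] Lo(3) assms(1)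
      by (auto simp: Y2_def intro: le_trans)
    ultimately show ?thesis
      using Lo(1) by simp
  qed
  show thesis
  proof (rule that[of Y2])
    show "Y2 \<subseteq> Y1" "card Y1 < card Y2 + K"
      using c Lo by (auto simp: Y2_def)
    fix y y'
    assume "y \<in> Y2" "y' \<in> Y2" "y \<noteq> y'"
    then show "\<exists>R. pth c R \<and> R \<noteq> [] \<and> hd R = y \<and> last R = y' \<and> set R \<subseteq> Y2 \<and> card Y2 \<le> length R + 9 * K"
      using c Lo K assms(1) deg by (intro nearly_spanning_path no) (auto simp: Y2_def)
  qed
qed

section \<open>Giant components, cores and exits\<close>

lemma big_comps_eq:
  assumes "finite W" "card W < card (comp c W x) + card (comp c W y)"
  shows "comp c W x = comp c W y"
proof -
  have "comp c W x \<inter> comp c W y \<noteq> {}"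
  proof
    assume "comp c W x \<inter> comp c W y = {}"
    then have "card (comp c W x \<union> comp c W y) = card (comp c W x) + card (comp c W y)"
      using assms(1) comp_subset by (meson card_Un_disjoint finite_subset)
    moreover have "card (comp c W x \<union> comp c W y) \<le> card W"
      using assms(1) comp_subset by (intro card_mono) blast+
    ultimately show False
      using assms(2) by simp
  qed
  then obtain z where "z \<in> comp c W x" "z \<in> comp c W y"
    by blast
  then show ?thesis
    using comp_eq[of z] by metis
qed

text \<open>The component of \<open>x\<close> does not shrink from \<open>W n\<close> to
  \<open>W (Suc n)\<close>, and there it is too large to be disjoint from the big one. So the vertex
  chosen at stage \<open>m\<close> serves all later stages.\<close>

lemma nested_comps:
  assumes fin: "\<And>n. finite (W n)" and mono: "\<And>n. W n \<subseteq> W (Suc n)"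
    and big: "\<And>n. m \<le> n \<Longrightarrow> \<exists>x. t n \<le> card (comp c (W n) x)"
    and t: "\<And>n. m \<le> n \<Longrightarrow> card (W (Suc n)) < t n + t (Suc n)"
  shows "\<exists>x. \<forall>n\<ge>m. t n \<le> card (comp c (W n) x)"
proof -
  obtain x where x: "t m \<le> card (comp c (W m) x)"
    using big by blast
  have "t n \<le> card (comp c (W n) x)" if "m \<le> n" for n
    using that
  proof (induction n rule: dec_induct)
    case base
    show ?case
      by (rule x)
  next
    case (step n)
    obtain x' where x': "t (Suc n) \<le> card (comp c (W (Suc n)) x')"
      using big[of "Suc n"] step.hyps by auto
    have "card (comp c (W n) x) \<le> card (comp c (W (Suc n)) x)"
      using comp_mono[OF mono] finite_subset[OF comp_subset fin] by (intro card_mono) auto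
    then have "comp c (W (Suc n)) x = comp c (W (Suc n)) x'"
      using t[OF step.hyps(1)] step.IH x' by (intro big_comps_eq fin) linarith
    then show ?case
      using x' by simp
  qed
  then show ?thesis
    by blast
qed

text \<open>Since \<open>comp c W z\<close> is empty for \<open>z \<notin> W\<close>, the bound forces \<open>z \<notin> F\<close>; this is why \<open>1 \<le> n\<close> is included.\<close>

definition core :: "bool \<Rightarrow> nat set \<Rightarrow> nat set"
  where "core c F = {z. \<exists>n0. \<forall>n\<ge>n0. 1 \<le> n \<and> 2 * n \<le> 3 * card (comp c ({1..n} - F) z)}"

text \<open>All of \<open>{1..n}\<close> except \<open>v\<close> is removed. So whatever vertices a
  path in \<open>{1..n}\<close> has used before it ends in \<open>v\<close>, by
  \<open>core_antimono\<close> the vertex \<open>v\<close> belongs to the core of what is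
  left.\<close>

definition exits :: "bool \<Rightarrow> nat \<Rightarrow> nat set"
  where "exits c n = {v \<in> {1..n}. v \<in> core c ({1..n} - {v})}"

lemma core_pos:
  assumes "z \<in> core c F"
  shows "1 \<le> z" "z \<notin> F"
proof -
  obtain n where "1 \<le> n" "2 * n \<le> 3 * card (comp c ({1..n} - F) z)"
    using assms by (auto simp: core_def)
  then have "comp c ({1..n} - F) z \<noteq> {}"
    by auto
  then show "1 \<le> z" "z \<notin> F"
    by (auto simp: comp_def)
qed

lemma core_antimono:
  assumes "F \<subseteq> F'"
  shows "core c F' \<subseteq> core c F"
proof
  fix z
  assume "z \<in> core c F'"
  then obtain n0 where n0: "\<And>n. n0 \<le> n \<Longrightarrow> 1 \<le> n \<and> 2 * n \<le> 3 * card (comp c ({1..n} - F') z)"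
    by (auto simp: core_def)
  have "card (comp c ({1..n} - F') z) \<le> card (comp c ({1..n} - F) z)" for n
  proof (intro card_mono comp_mono)
    show "finite (comp c ({1..n} - F) z)"
      by (rule finite_subset[OF comp_subset]) simp
  qed (use assms in auto)
  then have "\<forall>n\<ge>n0. 1 \<le> n \<and> 2 * n \<le> 3 * card (comp c ({1..n} - F) z)"
    using n0 by (meson le_trans mult_le_mono2)
  then show "z \<in> core c F"
    unfolding core_def by blast
qed

lemma core_comp:
  assumes "x \<in> core c F" "y \<in> comp c ({1..m} - F) x"
  shows "y \<in> core c F"
proof -
  obtain n0 where n0: "\<And>n. n0 \<le> n \<Longrightarrow> 1 \<le> n \<and> 2 * n \<le> 3 * card (comp c ({1..n} - F) x)"
    using assms(1) by (auto simp: core_def)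
  have "comp c ({1..n} - F) y = comp c ({1..n} - F) x" if "m \<le> n" for n
  proof (rule comp_eq)
    have "{1..m} - F \<subseteq> {1..n} - F"
      using that by auto
    then show "y \<in> comp c ({1..n} - F) x"
      using assms(2) comp_mono by blast
  qed
  then have "\<forall>n\<ge>max n0 m. 1 \<le> n \<and> 2 * n \<le> 3 * card (comp c ({1..n} - F) y)"
    using n0 by simp
  then show ?thesis
    unfolding core_def by blast
qed

lemma core_adj:
  assumes "x \<in> core c F" "adj c x y" "1 \<le> y" "y \<notin> F"
  shows "y \<in> core c F"
proof (rule core_comp[OF assms(1)])
  have "x \<in> {1..max x y} - F"
    using core_pos[OF assms(1)] by simp
  then show "y \<in> comp c ({1..max x y} - F) x"
    using assms comp_closed[OF comp_self[of x]] by simp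
qed

lemma exits_if_adj:
  assumes "v \<in> {1..n}" "z \<in> core c {1..n}" "adj c v z"
  shows "v \<in> exits c n"
proof -
  have "z \<in> core c ({1..n} - {v})"
    using assms(2) core_antimono[of "{1..n} - {v}" "{1..n}"] by blast
  then have "v \<in> core c ({1..n} - {v})"
    using assms adj_sym core_adj by auto
  then show ?thesis
    using assms by (simp add: exits_def)
qed

end

text \<open>The case in which \<open>extension_without_giants\<close> applies to neither colour.
  Here \<open>x\<close> may still depend on \<open>n\<close>; \<open>core_nonempty\<close> removes
  this dependence.\<close>

locale giant_colouring = edge_colouring +
  assumes giants: "finite F \<Longrightarrow> \<exists>n0. \<forall>n\<ge>n0. \<exists>x. 2 * n \<le> 3 * card (comp c ({1..n} - F) x)"
begin

lemma core_nonempty: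
  assumes "finite F"
  shows "core c F \<noteq> {}"
proof -
  obtain n0 where n0: "\<And>n. n0 \<le> n \<Longrightarrow> \<exists>x. 2 * n \<le> 3 * card (comp c ({1..n} - F) x)"
    using giants[OF assms] by blast
  \<comment> \<open>\<open>(2 * n + 2) div 3\<close> is 2n/3 rounded up. The thresholds for
    \<open>n\<close> and \<open>n + 1\<close> add up to more than \<open>n + 1\<close> only from
    \<open>n = 1\<close> on.\<close>
  have "\<exists>x. \<forall>n\<ge>max n0 1. (2 * n + 2) div 3 \<le> card (comp c ({1..n} - F) x)"
  proof (rule nested_comps)
    show "\<exists>x. (2 * n + 2) div 3 \<le> card (comp c ({1..n} - F) x)" if n: "max n0 1 \<le> n" for n
    proof -
      obtain x where "2 * n \<le> 3 * card (comp c ({1..n} - F) x)"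
        using n0[of n] n by auto
      then show ?thesis
        by (intro exI[of _ x]) linarith
    qed
    show "card ({1..Suc n} - F) < (2 * n + 2) div 3 + (2 * Suc n + 2) div 3" if "max n0 1 \<le> n" for n
    proof -
      have "card ({1..Suc n} - F) \<le> card {1..Suc n}"
        by (intro card_mono) auto
      then show ?thesis
        using that by simp presburger
    qed
  qed auto
  then obtain x where x: "\<And>n. max n0 1 \<le> n \<Longrightarrow> (2 * n + 2) div 3 \<le> card (comp c ({1..n} - F) x)"
    by blast
  have "2 * n \<le> 3 * card (comp c ({1..n} - F) x)" if "max n0 1 \<le> n" for n
    using x[OF that] by linarith
  then have "\<forall>n\<ge>max n0 1. 1 \<le> n \<and> 2 * n \<le> 3 * card (comp c ({1..n} - F) x)"
    by auto
  then show ?thesis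
    unfolding core_def by blast
qed

lemma cores_meet:
  assumes "finite F"
  shows "\<exists>z. z \<in> core c F \<and> z \<in> core c' F"
proof -
  obtain x y where xy: "x \<in> core c F" "y \<in> core c' F"
    using core_nonempty[OF assms] by blast
  obtain n1 where n1: "\<And>n. n1 \<le> n \<Longrightarrow> 1 \<le> n \<and> 2 * n \<le> 3 * card (comp c ({1..n} - F) x)"
    using xy(1) by (auto simp: core_def)
  obtain n2 where n2: "\<And>n. n2 \<le> n \<Longrightarrow> 1 \<le> n \<and> 2 * n \<le> 3 * card (comp c' ({1..n} - F) y)"
    using xy(2) by (auto simp: core_def)
  define n where "n = max n1 n2"
  have "comp c ({1..n} - F) x \<inter> comp c' ({1..n} - F) y \<noteq> {}"
  proof
    assume "comp c ({1..n} - F) x \<inter> comp c' ({1..n} - F) y = {}"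
    then have "card (comp c ({1..n} - F) x \<union> comp c' ({1..n} - F) y) =
        card (comp c ({1..n} - F) x) + card (comp c' ({1..n} - F) y)"
      using finite_subset[OF comp_subset] by (intro card_Un_disjoint) auto
    moreover have "card (comp c ({1..n} - F) x \<union> comp c' ({1..n} - F) y) \<le> card {1..n}"
      using comp_subset by (intro card_mono) blast+
    ultimately show False
      using n1[of n] n2[of n] by (simp add: n_def)
  qed
  then show ?thesis
    using core_comp[OF xy(1)] core_comp[OF xy(2)] by blast
qed

text \<open>Take a vertex in the cores of both colours beyond \<open>N\<close>. Joined to it in
  colour \<open>\<not> c\<close>, \<open>v\<close> would be an exit of that colour, so the edge has
  colour \<open>c\<close> and leads from \<open>v\<close> into the core of \<open>c\<close>.\<close>

lemma exits_if_not_exits: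
  assumes "v \<in> {1..n}" "v \<notin> exits (\<not> c) n" "n \<le> N"
  shows "v \<in> exits c N"
proof -
  obtain z where z: "z \<in> core c {1..N}" "z \<in> core (\<not> c) {1..N}"
    using cores_meet[of "{1..N}"] by blast
  have "z \<in> core (\<not> c) {1..n}"
    using z(2) core_antimono[of "{1..n}" "{1..N}"] assms(3) by auto
  then have "\<not> adj (\<not> c) v z"
    using exits_if_adj assms by blast
  moreover have "v \<noteq> z"
    using core_pos[OF z(1)] assms by auto
  ultimately have "adj c v z"
    using adj_total' by simp
  then show ?thesis
    using exits_if_adj[OF _ z(1)] assms by simp
qed

text \<open>
  The vertices \<open>X\<close> of \<open>{1..n}\<close> that are no exits in the other colour are joined in colour \<open>c\<close> to the
  whole core of the other colour. Take the last \<open>N\<close> for which all components of the other colour in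
  \<open>{n<..N}\<close> are small: at \<open>N + 1\<close> most of \<open>{n<..N}\<close> merges into that core, hence is joined to \<open>X\<close>.
\<close>

lemma few_non_exits:
  assumes F: "finite F" and e: "e \<in> core c F" and k: "1 \<le> k"
  shows "\<exists>n1. \<forall>n\<ge>n1. 2 * n \<le> 3 * card ({1..n} - exits (\<not> c) n) + (n div k) div 2 \<longrightarrow>
    (\<exists>N\<ge>n. \<exists>L. pth c L \<and> L \<noteq> [] \<and> hd L = e \<and> last L \<in> exits c N \<and> set L \<subseteq> {1..N} - F \<and>
       2 * N \<le> 3 * length L + N div k)"
proof -
  obtain ne where ne: "\<And>n. ne \<le> n \<Longrightarrow> 1 \<le> n \<and> 2 * n \<le> 3 * card (comp c ({1..n} - F) e)"
    using e by (auto simp: core_def)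
  obtain mF where mF: "F \<subseteq> {..mF}"
    using F finite_nat_iff_bounded_le by auto
  define f where "f = card F"
  \<comment> \<open>\<open>ne\<close> provides the giant component of \<open>e\<close>,
    \<open>mF\<close> keeps \<open>F\<close> below \<open>n\<close>, and the last summand makes
    \<open>n div k\<close> at least \<open>6 * f + 40\<close>, which absorbs the constant
    losses.\<close>
  define n1 where "n1 = ne + mF + k * (6 * f + 40)"
  have goal: "\<exists>N\<ge>n. \<exists>L. pth c L \<and> L \<noteq> [] \<and> hd L = e \<and> last L \<in> exits c N \<and> set L \<subseteq> {1..N} - F \<and>
       2 * N \<le> 3 * length L + N div k"
    if n: "n1 \<le> n" and dead: "2 * n \<le> 3 * card ({1..n} - exits (\<not> c) n) + (n div k) div 2" for n
  proof -
    define q where "q = n div k"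
    have "k * (6 * f + 40) \<le> n"
      using n by (simp add: n1_def)
    then have q: "6 * f + 40 \<le> q"
      using k by (simp add: q_def less_eq_div_iff_mult_less_eq mult.commute)
    have qn: "q \<le> n"
      by (simp add: q_def)
    define X where "X = {1..n} - exits (\<not> c) n - F"
    have Xf: "finite X" "X \<subseteq> {1..n}"
      by (auto simp: X_def)
    have cX: "2 * n \<le> 3 * card X + 3 * f + q div 2"
      using dead diff_card_le_card_Diff[OF F, of "{1..n} - exits (\<not> c) n"]
      by (simp add: X_def f_def q_def)
    define G where "G = core (\<not> c) {1..n}"
    have XG: "\<not> adj (\<not> c) v z" if "v \<in> X" "z \<in> G" for v z
      using exits_if_adj[of v n z "\<not> c"] that by (auto simp: X_def G_def)
    have fin: "finite (comp (\<not> c) {n<..m} x)" for m x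
      by (rule finite_subset[OF comp_subset]) simp
    \<comment> \<open>The set \<open>T\<close> below has about N - n/3 vertices. A component of size
      (2N - n)/3 leaves about N/3 of them, which is what \<open>multipartite_path\<close> needs for
      a path with 2N/3 vertices.\<close>
    define P where "P N \<longleftrightarrow> (\<forall>x. 3 * card (comp (\<not> c) {n<..N} x) + n \<le> 2 * N)" for N
    obtain n2 where n2: "\<And>m. n2 \<le> m \<Longrightarrow> \<exists>x. 2 * m \<le> 3 * card (comp (\<not> c) ({1..m} - {1..n}) x)"
      using giants[of "{1..n}"] by blast
    have diff: "{1..m} - {1..n} = {n<..m}" for m
      by auto
    have notP: "\<not> P m" if m: "n2 \<le> m" for m
    proof
      assume "P m"
      moreover obtain x where "2 * m \<le> 3 * card (comp (\<not> c) {n<..m} x)"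
        using n2[OF m] unfolding diff by blast
      ultimately have "2 * m + n \<le> 2 * m"
        unfolding P_def by (meson add_le_mono1 le_trans)
      then show False
        using q qn by simp
    qed
    have "card (comp (\<not> c) {n<..2 * n} x) \<le> card {n<..2 * n}" for x
      by (intro card_mono comp_subset) simp
    then have "3 * card (comp (\<not> c) {n<..2 * n} x) + n \<le> 2 * (2 * n)" for x
      using mult_le_mono2[of "card (comp (\<not> c) {n<..2 * n} x)" n 3] by simp
    then have P2: "P (2 * n)"
      unfolding P_def by blast
    define N where "N = Max {m. P m}"
    have finP: "finite {m. P m}"
      using notP by (meson finite_nat_set_iff_bounded linorder_not_less mem_Collect_eq)
    have PN: "P N"
      using Max_in[OF finP] P2 unfolding N_def by blast
    have nN: "2 * n \<le> N"
      unfolding N_def using P2 finP by (intro Max_ge) auto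
    have notPN: "\<not> P m" if "N < m" for m
      using Max_ge[OF finP, of m] that unfolding N_def by auto
    have "\<exists>x. \<forall>m\<ge>Suc N. (2 * m - n) div 3 + 1 \<le> card (comp (\<not> c) {n<..m} x)"
    proof (rule nested_comps)
      show "\<exists>x. (2 * m - n) div 3 + 1 \<le> card (comp (\<not> c) {n<..m} x)" if m: "Suc N \<le> m" for m
      proof -
        obtain x where "2 * m < 3 * card (comp (\<not> c) {n<..m} x) + n"
          using notPN[of m] m unfolding P_def by (meson Suc_le_lessD not_le)
        then have "2 * m - n < card (comp (\<not> c) {n<..m} x) * 3"
          using m nN by linarith
        then have "(2 * m - n) div 3 < card (comp (\<not> c) {n<..m} x)"
          by (rule less_mult_imp_div_less)
        then show ?thesis
          by (intro exI[of _ x]) simp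
      qed
      show "card {n<..Suc m} < (2 * m - n) div 3 + 1 + ((2 * Suc m - n) div 3 + 1)" if "Suc N \<le> m" for m
        using that nN q qn by simp
    qed auto
    then obtain x where x: "\<And>m. Suc N \<le> m \<Longrightarrow> (2 * m - n) div 3 + 1 \<le> card (comp (\<not> c) {n<..m} x)"
      by blast
    \<comment> \<open>At a late stage the component of \<open>x\<close> and that of a vertex of the
      core are too large to be disjoint.\<close>
    have xG: "x \<in> G"
    proof -
      obtain z where z: "z \<in> G"
        using core_nonempty[of "{1..n}"] by (auto simp: G_def)
      then obtain nz where nz: "\<And>m. nz \<le> m \<Longrightarrow> 2 * m \<le> 3 * card (comp (\<not> c) ({1..m} - {1..n}) z)"
        by (auto simp: G_def core_def)
      define m where "m = nz + N + 1"
      have eq: "comp (\<not> c) {n<..m} z = comp (\<not> c) {n<..m} x"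
      proof (rule big_comps_eq)
        have "2 * m \<le> 3 * card (comp (\<not> c) {n<..m} z)" "Suc N \<le> m"
          using nz[of m] unfolding diff by (simp_all add: m_def)
        then have "m < card (comp (\<not> c) {n<..m} z) + card (comp (\<not> c) {n<..m} x) + n"
          using x[of m] nN by linarith
        then show "card {n<..m} < card (comp (\<not> c) {n<..m} z) + card (comp (\<not> c) {n<..m} x)"
          using \<open>Suc N \<le> m\<close> nN by simp
      qed simp
      have "comp (\<not> c) {n<..m} x \<noteq> {}"
        using x[of m] by (auto simp: m_def)
      then have "x \<in> comp (\<not> c) {n<..m} z"
        unfolding eq by (auto simp: comp_def)
      then show ?thesis
        using core_comp[of z "\<not> c" "{1..n}" x m] z unfolding G_def diff by blast
    qed
    define D where "D = comp (\<not> c) {n<..Suc N} x"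
    have DG: "D \<subseteq> G"
      using core_comp[of x "\<not> c" "{1..n}" _ "Suc N"] xG unfolding G_def diff D_def by blast
    have cD: "2 * Suc N < 3 * card D + n"
      using x[of "Suc N"] by (simp add: D_def)
    have Dsub: "D \<subseteq> {n<..Suc N}"
      by (simp add: D_def comp_subset)
    define T where "T = {n<..N} \<union> X"
    have T: "finite T" "T \<subseteq> {1..N} - F"
      using nN Xf mF n by (auto simp: T_def X_def n1_def)
    have "{n<..N} \<inter> X = {}"
      using Xf(2) by auto
    then have cT: "card T = N - n + card X"
      using Xf(1) by (simp add: T_def card_Un_disjoint)
    define s where "s = (N - q div 2 - 3 * f - 12) div 3"
    have bound: "3 * s + 12 + 3 * f + q div 2 \<le> N" "N \<le> 3 * s + 15 + 3 * f + q div 2"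
      using q qn nN unfolding s_def by linarith+
    \<comment> \<open>No edge of colour \<open>\<not> c\<close> joins \<open>D\<close> to
      \<open>X\<close>. So a component that meets \<open>D - {Suc N}\<close> stays inside
      \<open>{n<..N}\<close> and is bounded by \<open>P N\<close>; any other one misses
      \<open>D - {Suc N}\<close>, which has at least N/3 vertices.\<close>
    have small: "card (comp (\<not> c) T y) + s + 3 \<le> card T" if y: "y \<in> T" for y
    proof (cases "y \<in> D - {Suc N}")
      case True
      have yN: "y \<in> {n<..N}"
        using True Dsub by auto
      have "comp (\<not> c) T y \<subseteq> comp (\<not> c) {n<..N} y \<inter> D"
      proof (rule comp_least)
        show "y \<in> comp (\<not> c) {n<..N} y \<inter> D"
          using yN True comp_self by blast
        fix u z
        assume u: "u \<in> comp (\<not> c) {n<..N} y \<inter> D" and z: "z \<in> T" "adj (\<not> c) u z"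
        have "z \<notin> X"
          using XG[of z u] u z DG adj_sym by blast
        then have zN: "z \<in> {n<..N}"
          using z by (simp add: T_def)
        then show "z \<in> comp (\<not> c) {n<..N} y \<inter> D"
          using u z(2) comp_closed[of u "\<not> c" "{n<..N}" y z] comp_closed[of u "\<not> c" "{n<..Suc N}" x z]
          by (simp add: D_def)
      qed
      then have "card (comp (\<not> c) T y) \<le> card (comp (\<not> c) {n<..N} y)"
        using fin by (intro card_mono) auto
      moreover have "3 * card (comp (\<not> c) {n<..N} y) + n \<le> 2 * N"
        using PN by (simp add: P_def)
      ultimately show ?thesis
        using cX cT bound(1) nN by linarith
    next
      case False
      have "comp (\<not> c) T y \<subseteq> T - (D - {Suc N})"
      proof (rule comp_least)
        show "y \<in> T - (D - {Suc N})"
          using y False by blast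
        fix u z
        assume u: "u \<in> T - (D - {Suc N})" and z: "z \<in> T" "adj (\<not> c) u z"
        have "z \<notin> D - {Suc N}"
        proof
          assume zD: "z \<in> D - {Suc N}"
          have "u \<notin> X"
            using XG[of u z] z(2) zD DG by blast
          then have "u \<in> {n<..Suc N}" "u \<noteq> Suc N"
            using u by (auto simp: T_def)
          then have "u \<in> D - {Suc N}"
            using comp_closed[of z "\<not> c" "{n<..Suc N}" x u] zD z(2) adj_sym by (simp add: D_def)
          then show False
            using u by blast
        qed
        then show "z \<in> T - (D - {Suc N})"
          using z by blast
      qed
      then have cK: "card (comp (\<not> c) T y) \<le> card (T - (D - {Suc N}))"
        using T(1) by (intro card_mono) auto
      have "D - {Suc N} \<subseteq> T" "finite D"
        using Dsub finite_subset[OF Dsub] by (auto simp: T_def)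
      then have cTD: "card (T - (D - {Suc N})) + card (D - {Suc N}) = card T"
        using T(1) by (metis card_Diff_subset card_mono finite_Diff le_add_diff_inverse2)
      have "card D \<le> card (D - {Suc N}) + 1"
        by (auto simp: card_Diff_singleton_if)
      moreover have "N \<le> 3 * b" if "a \<le> b + 1" "2 * Suc N < 3 * a + n" for a b :: nat
      proof -
        have "3 * a \<le> 3 * b + 3"
          using that(1) by simp
        moreover have "2 * N + 2 < 3 * a + n"
          using that(2) by simp
        ultimately have "2 * N \<le> 3 * b + n"
          by linarith
        then show ?thesis
          using nN by linarith
      qed
      ultimately have "N \<le> 3 * card (D - {Suc N})"
        using cD by blast
      then have "s + 3 \<le> card (D - {Suc N})"
        using bound(1) by linarith
      then show ?thesis
        using cK cTD by simp
    qed
    have n_e: "2 * N \<le> 3 * card (comp c ({1..N} - F) e)"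
      using ne[of N] n nN by (simp add: n1_def)
    have n_T: "N < 3 * card T"
      using cT cX nN q qn by linarith
    have n_W: "card ({1..N} - F) \<le> N"
      using card_mono[of "{1..N}" "{1..N} - F"] by simp
    \<comment> \<open>The component of \<open>e\<close> has two thirds of \<open>{1..N}\<close> and
      \<open>T\<close> more than one third.\<close>
    have "comp c ({1..N} - F) e \<inter> T \<noteq> {}"
    proof
      assume disj: "comp c ({1..N} - F) e \<inter> T = {}"
      have "finite (comp c ({1..N} - F) e)"
        by (rule finite_subset[OF comp_subset]) simp
      then have "card (comp c ({1..N} - F) e \<union> T) = card (comp c ({1..N} - F) e) + card T"
        using T(1) disj by (rule card_Un_disjoint)
      moreover have "card (comp c ({1..N} - F) e \<union> T) \<le> card ({1..N} - F)"
        using T(2) comp_subset by (intro card_mono) auto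
      ultimately show False
        using n_e n_T n_W by linarith
    qed
    then obtain t where t: "t \<in> comp c ({1..N} - F) e" "t \<in> T"
      by blast
    obtain ls where ls: "pth c ls" "ls \<noteq> []" "hd ls = e" "last ls \<in> T" "set ls \<subseteq> {1..N} - F"
      "set (butlast ls) \<inter> T = {}"
      by (rule shortest_path_to_set[OF t]) blast
    have "2 \<le> card X"
      using cX q qn by linarith
    then have "\<not> X \<subseteq> {last ls}"
      using card_mono[of "{last ls}" X] by auto
    then obtain v where v: "v \<in> X" "last ls \<noteq> v"
      by blast
    have "\<exists>xs. pth c xs \<and> xs \<noteq> [] \<and> hd xs = last ls \<and> last xs = v \<and> set xs \<subseteq> T \<and> 2 * s \<le> length xs"
    proof (rule multipartite_path[OF T(1) ls(4) _ v(2) small])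
      show "v \<in> T"
        using v by (simp add: T_def)
      show "2 * s + 2 \<le> card T" "2 \<le> s"
        using cT cX bound nN q qn by linarith+
    qed
    then obtain xs where xs: "pth c xs" "xs \<noteq> []" "hd xs = last ls" "last xs = v" "set xs \<subseteq> T" "2 * s \<le> length xs"
      by blast
    define L where "L = butlast ls @ xs"
    have "ls = butlast ls @ [last ls]"
      using ls(2) by simp
    then have "pth c (butlast ls) \<and> (butlast ls = [] \<or> adj c (last (butlast ls)) (last ls))"
      using ls(1) pth_append[of c "butlast ls" "[last ls]"] by simp
    then have L: "pth c L"
      unfolding L_def pth_append using xs ls(6) by auto
    have "hd L = e"
      using ls(2,3) xs(2,3) by (cases ls rule: rev_cases) (auto simp: L_def hd_append)
    moreover have "last L \<in> exits c N"
      using exits_if_not_exits[of v n c N] v(1) nN xs(2,4) by (auto simp: L_def X_def)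
    moreover have "set L \<subseteq> {1..N} - F"
      using ls(5) xs(5) T(2) by (auto simp: L_def dest: in_set_butlastD)
    \<comment> \<open>As \<open>N\<close> is at least \<open>2 * n\<close>, the permitted error at
      \<open>N\<close> is at least \<open>2 * q\<close>; this pays for the error
      \<open>q div 2\<close> in the number of non-exits as well as for the rounding in
      \<open>s\<close>.\<close>
    moreover have "2 * N \<le> 3 * length L + N div k"
    proof -
      have "2 * q * k \<le> N"
        using mult_le_mono2[OF div_times_less_eq_dividend[of n k], of 2] nN
        by (simp only: q_def mult.assoc)
      then have "2 * q \<le> N div k"
        using k by (simp add: less_eq_div_iff_mult_less_eq)
      then show ?thesis
        using xs(6) bound(2) q by (simp add: L_def)
    qed
    moreover have "n \<le> N" "L \<noteq> []"
      using nN xs(2) by (auto simp: L_def)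
    ultimately show ?thesis
      using L by blast
  qed
  show ?thesis
    using goal by (intro exI[of _ n1]) blast
qed

end

section \<open>A longest monochromatic path up to a fixed bound\<close>

text \<open>\<open>I\<close> and its shift by one are disjoint subsets of
  \<open>{..p}\<close>.\<close>

lemma card_no_consecutive:
  assumes "I \<subseteq> {..<p}" "\<And>i. i \<in> I \<Longrightarrow> Suc i \<notin> I"
  shows "2 * card I \<le> p + 1"
proof -
  have fin: "finite I"
    using assms(1) finite_subset by blast
  have "card (I \<union> Suc ` I) = card I + card (Suc ` I)"
    using fin assms(2) by (intro card_Un_disjoint) auto
  also have "card (Suc ` I) = card I"
    by (simp add: card_image)
  finally have "2 * card I = card (I \<union> Suc ` I)"
    by simp
  also have "\<dots> \<le> card {..p}"
    using assms(1) by (intro card_mono) auto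
  finally show ?thesis
    by simp
qed

lemma meet_if_large:
  fixes A B :: "nat set"
  assumes "A \<subseteq> {1..n}" "B \<subseteq> {1..n}" "n < card A + card B"
  shows "A \<inter> B \<noteq> {}"
proof
  assume "A \<inter> B = {}"
  then have "card (A \<union> B) = card A + card B"
    using assms(1,2) finite_subset by (intro card_Un_disjoint) blast+
  moreover have "card (A \<union> B) \<le> card {1..n}"
    using assms(1,2) by (intro card_mono) auto
  ultimately show False
    using assms(3) by simp
qed

context edge_colouring
begin

text \<open>In use, \<open>e\<close> is the end of a path built so far and \<open>F\<close> consists
  of its other vertices.\<close>

definition route :: "bool \<Rightarrow> nat set \<Rightarrow> nat \<Rightarrow> nat \<Rightarrow> nat list \<Rightarrow> bool"
  where "route c F e n L \<longleftrightarrow>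
    pth c L \<and> L \<noteq> [] \<and> hd L = e \<and> last L \<in> exits c n \<and> set L \<subseteq> {1..n} - F"

end

text \<open>The colour \<open>c\<close> is the one with the longer longest route; \<open>F\<close>,
  \<open>e\<close> and \<open>F'\<close>, \<open>e'\<close> are unrelated, since the two colours get
  stuck separately. The aim is a contradiction: the route found in \<open>long_route'\<close> is
  excluded by \<open>longest'\<close> and \<open>short\<close>. The bound on \<open>q\<close> is a
  generous multiple of \<open>K\<close> and the sizes of \<open>F\<close> and
  \<open>F'\<close>.\<close>

locale longest_route = edge_colouring +
  fixes c :: bool and n q :: nat and F F' :: "nat set" and e e' :: nat and P :: "nat list"
  assumes fin: "finite F" "finite F'"
    and P: "route c F e n P"
    and longest: "\<And>L. route c F e n L \<Longrightarrow> length L \<le> length P"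
    and longest': "\<And>L. route (\<not> c) F' e' n L \<Longrightarrow> length L \<le> length P"
    and short: "3 * length P + q < 2 * n"
    and long: "4 * card F' + 18 \<le> length P"
    and non_exits: "3 * card ({1..n} - exits c n) + q div 2 < 2 * n"
      "3 * card ({1..n} - exits (\<not> c) n) + q div 2 < 2 * n"
    and giant: "2 * n \<le> 3 * card (comp c ({1..n} - F) e)"
      "2 * n \<le> 3 * card (comp (\<not> c) ({1..n} - F') e')"
    and q: "100 * card F + 900 * card F' + 2500 \<le> q" "q \<le> n"
begin

abbreviation "p \<equiv> length P"

text \<open>By \<open>long_path\<close> the zigzag along \<open>P\<close> loses up to
  \<open>8 * card F' + 22\<close> vertices, and one more if \<open>p\<close> is odd. This is the
  least length of an inner path that makes the result longer than \<open>P\<close>.\<close>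

definition "K = 8 * card F' + 24"

definition "Y = {1..n} - F - F' - set P"

lemma P_simps: "pth c P" "P \<noteq> []" "hd P = e" "last P \<in> exits c n" "set P \<subseteq> {1..n} - F"
  using P by (auto simp: route_def)

lemma P_distinct: "i < p \<Longrightarrow> j < p \<Longrightarrow> P ! i = P ! j \<longleftrightarrow> i = j"
  using pth_distinct[OF P_simps(1)] by (simp add: nth_eq_iff_index_eq)

lemma P_not_Y: "i < p \<Longrightarrow> P ! i \<notin> Y" "i < p \<Longrightarrow> y \<in> Y \<Longrightarrow> y \<noteq> P ! i"
  by (auto simp: Y_def)

lemma Y: "finite Y" "Y \<subseteq> {1..n} - F'" "Y \<subseteq> {1..n} - F" "Y \<inter> set P = {}"
  by (auto simp: Y_def)

lemma card_Y: "n \<le> card Y + p + card F + card F'"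
proof -
  have "{1..n} \<subseteq> Y \<union> set P \<union> F \<union> F'"
    by (auto simp: Y_def)
  then have "card {1..n} \<le> card (Y \<union> set P \<union> F \<union> F')"
    using Y(1) fin by (intro card_mono) auto
  also have "\<dots> \<le> card Y + card (set P) + card F + card F'"
    by (meson add_le_mono card_Un_le le_trans order_refl)
  finally show ?thesis
    using pth_length[OF P_simps(1)] by simp
qed

text \<open>A longer replacement of the segment between \<open>i\<close> and \<open>j\<close> would
  give a longer route with the same ends. Vertices of that segment may occur in
  \<open>R\<close>.\<close>

lemma no_detour:
  assumes "i < j" "j < p" "pth c R" "R \<noteq> []" "adj c (P ! i) (hd R)" "adj c (last R) (P ! j)"
    and "set R \<subseteq> {1..n} - F" "set R \<inter> set (take (Suc i) P) = {}" "set R \<inter> set (drop j P) = {}"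
  shows "length R + Suc i \<le> j"
proof -
  obtain xs where xs: "pth c xs" "xs \<noteq> []" "hd xs = hd P" "last xs = last P" "set xs \<subseteq> set P \<union> set R"
    "length xs + j = p + length R + Suc i"
    using insert_path[OF P_simps(1) assms(1-6,8,9)] by blast
  have "route c F e n xs"
    using xs P_simps assms(7) by (auto simp: route_def)
  then show ?thesis
    using longest[of xs] xs(6) by simp
qed

lemma no_detour_Y:
  assumes "i < j" "j < p" "pth c R" "R \<noteq> []" "adj c (P ! i) (hd R)" "adj c (last R) (P ! j)" "set R \<subseteq> Y"
  shows "length R + Suc i \<le> j"
  by (rule no_detour[OF assms(1-6)])
    (use assms(7) Y in \<open>auto dest: in_set_takeD in_set_dropD\<close>)

lemma edge_cover:
  assumes "Suc i < p" "y \<in> Y"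
  shows "adj (\<not> c) y (P ! i) \<or> adj (\<not> c) y (P ! Suc i)"
proof (rule ccontr)
  assume "\<not> ?thesis"
  then have "adj c y (P ! i)" "adj c y (P ! Suc i)"
    using P_not_Y(2)[OF _ assms(2)] assms(1) adj_total' by (metis Suc_lessD)+
  then show False
    using no_detour_Y[of i "Suc i" "[y]"] assms adj_sym by simp
qed

text \<open>The detour from \<open>P ! i\<close> via \<open>y\<close>, \<open>P ! (i + 2)\<close>,
  \<open>P ! (i + 1)\<close> and \<open>y'\<close> to \<open>P ! (i + 3)\<close> runs through the
  middle edge backwards and gains two vertices.\<close>

lemma no_alternation:
  assumes "i + 3 < p" "y \<in> Y" "y' \<in> Y" "y \<noteq> y'"
    and "adj c y (P ! i)" "adj c y' (P ! (i + 1))" "adj c y (P ! (i + 2))" "adj c y' (P ! (i + 3))"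
  shows False
proof -
  have y: "y \<notin> set P" "y' \<notin> set P" "P ! (i + 2) \<noteq> y" "P ! (i + 2) \<noteq> y'" "P ! (i + 1) \<noteq> y" "P ! (i + 1) \<noteq> y'"
    using assms(1-3) by (auto simp: Y_def)
  have "adj c (P ! (i + 2)) (P ! (i + 1))"
    using pth_nth_adj[OF P_simps(1), of "i + 1"] assms(1) adj_sym by simp
  then have R: "pth c [y, P ! (i + 2), P ! (i + 1), y']"
    using assms adj_sym y P_distinct[of "i + 2" "i + 1"] by (simp add: pth_Cons)
  have 1: "P ! (i + 2) \<notin> set (take (Suc i) P)" "P ! (i + 1) \<notin> set (take (Suc i) P)"
    "P ! (i + 2) \<notin> set (drop (i + 3) P)" "P ! (i + 1) \<notin> set (drop (i + 3) P)"
    using assms(1) P_distinct by (auto simp: in_set_conv_nth)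
  have "length [y, P ! (i + 2), P ! (i + 1), y'] + Suc i \<le> i + 3"
  proof (rule no_detour[OF _ _ R])
    show "set [y, P ! (i + 2), P ! (i + 1), y'] \<subseteq> {1..n} - F"
      using assms(1-3) Y(3) subsetD[OF P_simps(5) nth_mem[of "i + 1"]] subsetD[OF P_simps(5) nth_mem[of "i + 2"]]
      by auto
  qed (use assms 1 y adj_sym in \<open>auto dest: in_set_takeD in_set_dropD\<close>)
  then show False
    by simp
qed

text \<open>Suppose that there is no common neighbour, and that \<open>y\<close>, say, is not joined
  to \<open>P ! i\<close> in colour \<open>\<not> c\<close>. Then \<open>edge_cover\<close> joins
  \<open>y\<close> to the next vertex, so \<open>y'\<close> is not joined to that one but to the one
  after it, and so on. This is the pattern of \<open>no_alternation\<close>.\<close>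

lemma common_cover:
  assumes "i + 3 < p" "y \<in> Y" "y' \<in> Y" "y \<noteq> y'"
  shows "\<exists>m\<in>{i, i + 1, i + 2, i + 3}. adj (\<not> c) y (P ! m) \<and> adj (\<not> c) y' (P ! m)"
proof (rule ccontr)
  assume "\<not> ?thesis"
  then have no: "\<And>m. m \<in> {i, i + 1, i + 2, i + 3} \<Longrightarrow> \<not> adj (\<not> c) y (P ! m) \<or> \<not> adj (\<not> c) y' (P ! m)"
    by blast
  have tot: "adj c z (P ! m)" if "z \<in> Y" "m \<le> i + 3" "\<not> adj (\<not> c) z (P ! m)" for z m
    using that adj_total'[OF P_not_Y(2)[of m z]] assms(1) by simp
  have alt: False if z: "z \<in> Y" "z' \<in> Y" "z \<noteq> z'" "\<not> adj (\<not> c) z (P ! i)"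
    and no: "\<And>m. m \<in> {i, i + 1, i + 2, i + 3} \<Longrightarrow> \<not> adj (\<not> c) z (P ! m) \<or> \<not> adj (\<not> c) z' (P ! m)" for z z'
  proof -
    have "\<not> adj (\<not> c) z' (P ! (i + 1))"
      using edge_cover[of i z] no[of "i + 1"] z assms(1) by auto
    moreover from this have "\<not> adj (\<not> c) z (P ! (i + 2))"
      using edge_cover[of "i + 1" z'] no[of "i + 2"] z assms(1) by (auto simp: numeral_eq_Suc)
    moreover from this have "\<not> adj (\<not> c) z' (P ! (i + 3))"
      using edge_cover[of "i + 2" z] no[of "i + 3"] z assms(1) by (auto simp: numeral_eq_Suc)
    ultimately show False
      using no_alternation[OF assms(1) z(1-3)] tot z by simp
  qed
  show False
    using alt[of y y'] alt[of y' y] no assms(2-4) by blast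
qed

text \<open>Fix \<open>w0\<close> in \<open>Y' - D\<close>. By \<open>edge_cover\<close> it is
  joined in colour \<open>\<not> c\<close> to all but about p/2 < n/3 vertices of \<open>P\<close>,
  while more than a third of \<open>{1..n}\<close> are exits. The bound \<open>3 * K\<close> covers
  both applications: \<open>card D \<le> K + 2\<close> with \<open>Y' = Y\<close>, and three
  vertices in \<open>D\<close> with \<open>card (Y - Y') \<le> K + 1\<close>.\<close>

lemma exit_near:
  assumes Y': "Y' \<subseteq> Y" and D: "finite D" and const: "card D + card (Y - Y') \<le> 3 * K"
  shows "\<exists>v\<in>exits (\<not> c) n. v \<in> {1..n} - F' \<and> v \<notin> D \<and> (\<exists>w\<in>Y' - D. v = w \<or> v \<notin> Y' \<and> adj (\<not> c) v w)"
proof (rule ccontr)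
  assume contra: "\<not> ?thesis"
  have Ybig: "n + q \<le> 3 * card Y + 3 * card F + 3 * card F'"
    using card_Y short by linarith
  have Y'f: "finite Y'" "finite (Y - Y')"
    using Y' Y(1) finite_subset by auto
  have "card Y = card Y' + card (Y - Y')"
    using card_Diff_subset[OF Y'f(1) Y'] card_mono[OF Y(1) Y'] by simp
  then have "card D < card Y'"
    using Ybig const q by (simp add: K_def)
  then have "\<not> Y' \<subseteq> D"
    using card_mono[OF D, of Y'] by auto
  then obtain w0 where w0: "w0 \<in> Y'" "w0 \<notin> D"
    by blast
  then have w0Y: "w0 \<in> Y"
    using Y' by blast
  define I where "I = {i. i < p \<and> \<not> adj (\<not> c) w0 (P ! i)}"
  have "2 * card I \<le> p + 1"
    by (rule card_no_consecutive) (use edge_cover[OF _ w0Y] in \<open>auto simp: I_def\<close>)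
  moreover have "exits (\<not> c) n \<subseteq> F \<union> F' \<union> D \<union> (Y - Y') \<union> (!) P ` I"
  proof
    fix v
    assume v: "v \<in> exits (\<not> c) n"
    show "v \<in> F \<union> F' \<union> D \<union> (Y - Y') \<union> (!) P ` I"
    proof (rule ccontr)
      assume nv: "v \<notin> F \<union> F' \<union> D \<union> (Y - Y') \<union> (!) P ` I"
      have vn: "v \<in> {1..n} - F'"
        using v nv by (auto simp: exits_def)
      then have "v \<notin> Y'" "\<not> adj (\<not> c) v w0"
        using contra v nv w0 by blast+
      then have "v \<in> set P"
        using nv vn by (auto simp: Y_def)
      then obtain i where "i < p" "P ! i = v"
        by (auto simp: in_set_conv_nth)
      then have "i \<in> I"
        using \<open>\<not> adj (\<not> c) v w0\<close> adj_sym by (auto simp: I_def)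
      then show False
        using nv \<open>P ! i = v\<close> by auto
    qed
  qed
  then have "card (exits (\<not> c) n) \<le> card (F \<union> F' \<union> D \<union> (Y - Y') \<union> (!) P ` I)"
    using fin D Y'f by (intro card_mono) (auto simp: I_def)
  moreover have "\<dots> \<le> card F + card F' + card D + card (Y - Y') + card ((!) P ` I)"
    by (meson add_le_mono card_Un_le le_trans order_refl)
  moreover have "card ((!) P ` I) \<le> card I"
    by (rule card_image_le) (simp add: I_def)
  moreover have "n \<le> card ({1..n} - exits (\<not> c) n) + card (exits (\<not> c) n)"
  proof -
    have "exits (\<not> c) n \<subseteq> {1..n}"
      by (auto simp: exits_def)
    then show ?thesis
      using diff_card_le_card_Diff[of "exits (\<not> c) n" "{1..n}"] finite_subset by fastforce
  qed
  ultimately have "n \<le> card ({1..n} - exits (\<not> c) n) + card F + card F' + 3 * K + card I" "2 * card I \<le> p + 1"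
    using const by linarith+
  moreover have "q \<le> 2 * (q div 2) + 1"
    by linarith
  ultimately show False
    using non_exits(2) short q K_def by linarith
qed

text \<open>Giant components have two thirds of \<open>{1..n}\<close> and cannot miss more than a
  third. This is how routes of both colours get into \<open>Y\<close>.\<close>

lemma entry:
  assumes "Z \<subseteq> Y" "n < 3 * card Z"
  shows "\<exists>z. z \<in> comp c ({1..n} - F) e \<and> z \<in> Z" "\<exists>z. z \<in> comp (\<not> c) ({1..n} - F') e' \<and> z \<in> Z"
proof -
  have Z: "Z \<subseteq> {1..n}"
    using assms(1) Y(2) by blast
  have "comp c ({1..n} - F) e \<subseteq> {1..n}" "comp (\<not> c) ({1..n} - F') e' \<subseteq> {1..n}"
    using comp_subset by blast+
  moreover have "n < card (comp c ({1..n} - F) e) + card Z" "n < card (comp (\<not> c) ({1..n} - F') e') + card Z"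
    using giant assms(2) by linarith+
  ultimately show "\<exists>z. z \<in> comp c ({1..n} - F) e \<and> z \<in> Z" "\<exists>z. z \<in> comp (\<not> c) ({1..n} - F') e' \<and> z \<in> Z"
    using meet_if_large Z by blast+
qed

lemma route_if:
  "\<exists>xs. pth (\<not> c) xs \<and> xs \<noteq> [] \<and> hd xs = e' \<and> last xs \<in> exits (\<not> c) n \<and> set xs \<subseteq> {1..n} - F' \<and> m \<le> length xs + l
    \<Longrightarrow> m \<le> p + l"
proof -
  assume "\<exists>xs. pth (\<not> c) xs \<and> xs \<noteq> [] \<and> hd xs = e' \<and> last xs \<in> exits (\<not> c) n \<and> set xs \<subseteq> {1..n} - F' \<and>
    m \<le> length xs + l"
  then obtain xs where "route (\<not> c) F' e' n xs" "m \<le> length xs + l"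
    unfolding route_def by blast
  then show "m \<le> p + l"
    using longest'[of xs] by simp
qed

text \<open>Otherwise \<open>long_path\<close>, with disjoint pairs of consecutive vertices of
  \<open>P\<close> as windows, gives a route of colour \<open>\<not> c\<close> that is longer than
  \<open>P\<close> by the choice of \<open>K\<close>.\<close>

lemma no_inner_paths: "\<exists>y\<in>Y. \<forall>zs. pth (\<not> c) zs \<longrightarrow> set zs \<subseteq> Y - {y} \<longrightarrow> length zs \<noteq> K"
proof (rule ccontr)
  assume contra: "\<not> ?thesis"
  define ws where "ws = map (\<lambda>j. (P ! (2 * j), P ! (2 * j + 1))) [0..<p div 2]"
  have len: "length ws = p div 2"
    by (simp add: ws_def)
  have wset: "wset w \<subseteq> set P" if "w \<in> set ws" for w
    using that by (auto simp: ws_def wset_def intro!: nth_mem)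
  have big: "n + q \<le> 3 * card Y + 3 * card F + 3 * card F'"
    using card_Y short by linarith
  obtain y0 where y0: "y0 \<in> comp (\<not> c) ({1..n} - F') e'" "y0 \<in> Y"
    using entry(2)[of Y] big q by auto
  have "\<exists>xs. pth (\<not> c) xs \<and> xs \<noteq> [] \<and> hd xs = e' \<and> last xs \<in> exits (\<not> c) n \<and> set xs \<subseteq> {1..n} - F' \<and>
      2 * length ws + K \<le> length xs + (8 * card F' + 22)"
  proof (rule long_path[where Y = Y, OF Y(1,2) y0])
    show "sorted_wrt (\<lambda>w w'. wset w \<inter> wset w' = {}) ws"
      unfolding ws_def sorted_wrt_map
      by (rule sorted_wrt_mono_rel[OF _ sorted_wrt_upt]) (auto simp: wset_def P_distinct)
    show "wset w \<inter> Y = {}" if "w \<in> set ws" for w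
      using wset[OF that] Y(4) by blast
    show "\<exists>x\<in>wset w. adj (\<not> c) a x" if w: "w \<in> set ws" and a: "a \<in> Y" for w a
    proof -
      obtain j where "j < p div 2" "w = (P ! (2 * j), P ! (2 * j + 1))"
        using w by (auto simp: ws_def)
      then show ?thesis
        using edge_cover[of "2 * j" a] a by (auto simp: wset_def)
    qed
    show "successively (\<lambda>w w'. \<forall>a\<in>Y. \<forall>b\<in>Y. a \<noteq> b \<longrightarrow>
        (\<exists>x\<in>wset w \<union> wset w'. adj (\<not> c) a x \<and> adj (\<not> c) b x)) ws"
      unfolding successively_conv_nth
    proof (intro allI impI ballI)
      fix j a b
      assume j: "Suc j < length ws" and ab: "a \<in> Y" "b \<in> Y" "a \<noteq> b"
      have "2 * j + 3 < p"
        using j len by linarith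
      then have "\<exists>m\<in>{2 * j, 2 * j + 1, 2 * j + 2, 2 * j + 3}. adj (\<not> c) a (P ! m) \<and> adj (\<not> c) b (P ! m)"
        using common_cover ab by blast
      then show "\<exists>x\<in>wset (ws ! j) \<union> wset (ws ! Suc j). adj (\<not> c) a x \<and> adj (\<not> c) b x"
        using j len by (auto simp: ws_def wset_def numeral_3_eq_3)
    qed
    show "\<Union> (wset ` set ws) - ({1..n} - F') \<subseteq> F'"
      using wset P_simps(5) by blast
    show "\<exists>zs. pth (\<not> c) zs \<and> set zs \<subseteq> Y - {y} \<and> length zs = K" if "y \<in> Y" for y
      using contra that by blast
    show "\<exists>v\<in>exits (\<not> c) n. v \<in> {1..n} - F' \<and> v \<notin> D \<and> (\<exists>w\<in>Y - D. v = w \<or> v \<notin> Y \<and> adj (\<not> c) v w)"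
      if "finite D" "card D \<le> K + 2" for D
      using that by (intro exit_near) (auto simp: K_def)
    show "length ws + K + 2 \<le> card Y"
      using len big short q K_def by linarith
    have "2 * card F' + 8 \<le> length ws"
      using len long by linarith
    then show "2 * (card F' + 4) \<le> length ws"
      by simp
  qed (use fin in \<open>auto simp: K_def\<close>)
  then have "2 * length ws + K \<le> p + (8 * card F' + 22)"
    by (rule route_if)
  then show False
    using len K_def by linarith
qed

text \<open>Excluding the length \<open>K\<close> excludes all longer paths, since their first
  \<open>K\<close> vertices form a path. So \<open>nearly_spanning_subset\<close> applies to
  \<open>Y\<close> without the vertex from \<open>no_inner_paths\<close>.\<close>

lemma spanning_part:
  "\<exists>Y2\<subseteq>Y. card Y \<le> card Y2 + K \<and> card (Y - Y2) \<le> K \<and>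
    (\<forall>y\<in>Y2. \<forall>y'\<in>Y2. y \<noteq> y' \<longrightarrow>
       (\<exists>R. pth c R \<and> R \<noteq> [] \<and> hd R = y \<and> last R = y' \<and> set R \<subseteq> Y2 \<and> card Y2 \<le> length R + 9 * K))"
proof -
  obtain y where y: "y \<in> Y" and no: "\<And>zs. pth (\<not> c) zs \<Longrightarrow> set zs \<subseteq> Y - {y} \<Longrightarrow> length zs \<noteq> K"
    using no_inner_paths by blast
  have no': "length zs < K" if zs: "pth (\<not> c) zs" "set zs \<subseteq> Y - {y}" for zs
  proof (rule ccontr)
    assume "\<not> length zs < K"
    then have "length (take K zs) = K"
      by simp
    moreover have "set (take K zs) \<subseteq> Y - {y}"
      using zs(2) by (auto dest: in_set_takeD)
    ultimately show False
      using no[OF pth_take[OF zs(1)]] by blast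
  qed
  have cY: "card (Y - {y}) + 1 = card Y"
    using card_Suc_Diff1[OF Y(1) y] by linarith
  have "10 * K + 10 \<le> card (Y - {y})"
    using cY card_Y short q K_def by linarith
  then obtain Y2 where Y2: "Y2 \<subseteq> Y - {y}" "card (Y - {y}) < card Y2 + K"
    "\<And>y y'. y \<in> Y2 \<Longrightarrow> y' \<in> Y2 \<Longrightarrow> y \<noteq> y' \<Longrightarrow>
       \<exists>R. pth c R \<and> R \<noteq> [] \<and> hd R = y \<and> last R = y' \<and> set R \<subseteq> Y2 \<and> card Y2 \<le> length R + 9 * K"
    using nearly_spanning_subset[of "Y - {y}" c K] no' Y(1) by (auto simp: K_def)
  have "card (Y - Y2) = card Y - card Y2"
    using Y2(1) Y(1) by (intro card_Diff_subset) (auto intro: finite_subset)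
  then have "card (Y - Y2) \<le> K" "card Y \<le> card Y2 + K"
    using Y2(2) cY by linarith+
  moreover have "Y2 \<subseteq> Y"
    using Y2(1) by blast
  ultimately show ?thesis
    using Y2(3) by blast
qed

text \<open>Otherwise nearly two thirds of \<open>{1..n}\<close> lie in \<open>Y2\<close>. Since
  more than a third are exits, \<open>Y2\<close> contains one, and a path that enters
  \<open>Y2\<close> and runs through nearly all of it to this exit is longer than
  \<open>P\<close>.\<close>

lemma short_route: "n \<le> 3 * p"
proof (rule ccontr)
  assume p: "\<not> n \<le> 3 * p"
  obtain Y2 where Y2: "Y2 \<subseteq> Y" "card Y \<le> card Y2 + K"
    and spanning: "\<And>y y'. y \<in> Y2 \<Longrightarrow> y' \<in> Y2 \<Longrightarrow> y \<noteq> y' \<Longrightarrow>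
       \<exists>R. pth c R \<and> R \<noteq> [] \<and> hd R = y \<and> last R = y' \<and> set R \<subseteq> Y2 \<and> card Y2 \<le> length R + 9 * K"
    using spanning_part by blast
  have big: "2 * n \<le> 3 * card Y2 + 3 * K + 3 * card F + 3 * card F'"
    using card_Y Y2(2) p by linarith
  have "n < 3 * card Y2"
    using big q K_def by linarith
  then obtain z where z: "z \<in> comp c ({1..n} - F) e" "z \<in> Y2"
    using entry(1)[OF Y2(1)] by blast
  obtain ls where ls: "pth c ls" "ls \<noteq> []" "hd ls = e" "last ls \<in> Y2" "set ls \<subseteq> {1..n} - F"
    "set (butlast ls) \<inter> Y2 = {}"
    by (rule shortest_path_to_set[OF z]) blast
  have "exits c n \<subseteq> {1..n}"
    by (auto simp: exits_def)
  then have "n \<le> card ({1..n} - exits c n) + card (exits c n)"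
    using diff_card_le_card_Diff[of "exits c n" "{1..n}"] finite_subset by fastforce
  moreover have "card (Y2 - {last ls}) + 1 = card Y2"
    using card_Suc_Diff1[OF finite_subset[OF Y2(1) Y(1)] ls(4)] by linarith
  ultimately have "n < card (exits c n) + card (Y2 - {last ls})"
    using big non_exits(1) q K_def by linarith
  moreover have "Y2 - {last ls} \<subseteq> {1..n}"
    using Y2(1) Y(2) by blast
  ultimately have "exits c n \<inter> (Y2 - {last ls}) \<noteq> {}"
    using \<open>exits c n \<subseteq> {1..n}\<close> by (intro meet_if_large)
  then obtain y where y: "y \<in> exits c n" "y \<in> Y2" "last ls \<noteq> y"
    by blast
  obtain R where R: "pth c R" "R \<noteq> []" "hd R = last ls" "last R = y" "set R \<subseteq> Y2" "card Y2 \<le> length R + 9 * K"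
    using spanning[OF ls(4) y(2,3)] by blast
  have "ls = butlast ls @ [last ls]"
    using ls(2) by simp
  then have "pth c (butlast ls) \<and> (butlast ls = [] \<or> adj c (last (butlast ls)) (last ls))"
    using ls(1) pth_append[of c "butlast ls" "[last ls]"] by simp
  then have "pth c (butlast ls @ R)"
    unfolding pth_append using R ls(6) by auto
  moreover have "hd (butlast ls @ R) = e"
    using ls(2,3) R(2,3) by (cases ls rule: rev_cases) (auto simp: hd_append)
  moreover have "set (butlast ls @ R) \<subseteq> {1..n} - F"
    using ls(5) R(5) Y2(1) Y(3) by (auto dest: in_set_butlastD)
  ultimately have "route c F e n (butlast ls @ R)"
    using R y(1) by (simp add: route_def)
  then have "length R \<le> p"
    using longest by fastforce
  then show False
    using R(6) big p q K_def by linarith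
qed

text \<open>
  Two edges of colour \<open>c\<close> between \<open>Y2\<close> and a segment of \<open>P\<close> that share no vertex would allow a detour
  through nearly all of \<open>Y2\<close>. So these edges form a star, and off its centre everything between \<open>Y2\<close>
  and the segment has the other colour.
\<close>

lemma long_route':
  "\<exists>L. route (\<not> c) F' e' n L \<and> 2 * n \<le> 3 * length L + q"
proof -
  obtain Y2 where Y2: "Y2 \<subseteq> Y" "card Y \<le> card Y2 + K" "card (Y - Y2) \<le> K"
    and spanning: "\<And>y y'. y \<in> Y2 \<Longrightarrow> y' \<in> Y2 \<Longrightarrow> y \<noteq> y' \<Longrightarrow>
       \<exists>R. pth c R \<and> R \<noteq> [] \<and> hd R = y \<and> last R = y' \<and> set R \<subseteq> Y2 \<and> card Y2 \<le> length R + 9 * K"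
    using spanning_part by blast
  \<comment> \<open>The segment consists of the first \<open>h\<close> vertices of \<open>P\<close>,
    which exist by \<open>short_route\<close>. By \<open>big\<close>, a path through nearly all of
    \<open>Y2\<close> has more than \<open>h\<close> vertices, so it is too long for a detour
    between two of them.\<close>
  define h where "h = n div 3"
  have h: "h \<le> p" "3 * h \<le> n" "n \<le> 3 * h + 2"
    using short_route by (auto simp: h_def)
  have big: "n + q \<le> 3 * card Y2 + 3 * K + 3 * card F + 3 * card F'"
    using card_Y Y2(2) short by linarith
  have no_pair: False if "i < j" "j < h" "y \<in> Y2" "y' \<in> Y2" "y \<noteq> y'" "adj c (P ! i) y" "adj c (P ! j) y'" for i j y y'
  proof -
    obtain R where R: "pth c R" "R \<noteq> []" "hd R = y" "last R = y'" "set R \<subseteq> Y2" "card Y2 \<le> length R + 9 * K"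
      using spanning[OF \<open>y \<in> Y2\<close> \<open>y' \<in> Y2\<close> \<open>y \<noteq> y'\<close>] by blast
    have "length R + Suc i \<le> j"
      using R that Y2(1) h adj_sym by (intro no_detour_Y) auto
    then show False
      using R(6) big that(2) h q K_def by linarith
  qed
  have star: "i = j \<or> y = y'" if "i < h" "j < h" "y \<in> Y2" "y' \<in> Y2" "adj c (P ! i) y" "adj c (P ! j) y'" for i j y y'
    using no_pair[of i j y y'] no_pair[of j i y' y] that by (metis linorder_neqE_nat)
  \<comment> \<open>Any two edges of colour \<open>c\<close> share an end, so each shares one with a
    fixed edge from \<open>P ! i0\<close> to \<open>y0\<close>. Both ends are discarded, as either
    may be the centre; without such edges they are arbitrary.\<close>
  obtain i0 y0 where centre: "\<And>i y. i < h \<Longrightarrow> y \<in> Y2 \<Longrightarrow> adj c (P ! i) y \<Longrightarrow> i = i0 \<or> y = y0"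
  proof (cases "\<exists>i y. i < h \<and> y \<in> Y2 \<and> adj c (P ! i) y")
    case True
    then obtain i0 y0 where "i0 < h" "y0 \<in> Y2" "adj c (P ! i0) y0"
      by blast
    then show thesis
      using that[of i0 y0] star by blast
  next
    case False
    then show thesis
      using that by blast
  qed
  define Y3 where "Y3 = Y2 - {y0}"
  define idx where "idx = filter (\<lambda>i. i \<noteq> i0) [0..<h]"
  \<comment> \<open>Every vertex of these one-vertex windows is joined to all of \<open>Y3\<close>,
    so \<open>cover\<close> and \<open>common\<close> are immediate, and a single vertex will do as
    the inner path.\<close>
  define ws where "ws = map (\<lambda>i. (P ! i, P ! i)) idx"
  have Y3: "Y3 \<subseteq> Y" "finite Y3"
    using Y2(1) Y(1) finite_subset by (auto simp: Y3_def)
  have cY3: "card Y2 \<le> card Y3 + 1"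
    unfolding Y3_def by (auto simp: card_Diff_singleton_if)
  have "Y - Y3 \<subseteq> insert y0 (Y - Y2)"
    by (auto simp: Y3_def)
  then have "card (Y - Y3) \<le> card (insert y0 (Y - Y2))"
    using Y(1) by (intro card_mono) auto
  then have cYY3: "card (Y - Y3) \<le> K + 1"
    using Y2(3) Y(1) by (auto simp: card_insert_if split: if_splits)
  have idx_set: "set idx = {..<h} - {i0}"
    by (auto simp: idx_def)
  have "length idx = card (set idx)"
    by (rule distinct_card[symmetric]) (simp add: idx_def)
  then have len: "length ws \<le> h" "h \<le> length ws + 1"
    by (auto simp: ws_def idx_set card_Diff_singleton_if)
  have ws_adj: "\<exists>i<h. w = (P ! i, P ! i) \<and> (\<forall>a\<in>Y3. adj (\<not> c) a (P ! i))" if "w \<in> set ws" for w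
  proof -
    obtain i where i: "i < h" "i \<noteq> i0" "w = (P ! i, P ! i)"
      using \<open>w \<in> set ws\<close> idx_set by (auto simp: ws_def)
    have "adj (\<not> c) a (P ! i)" if a: "a \<in> Y3" for a
    proof (rule ccontr)
      assume "\<not> adj (\<not> c) a (P ! i)"
      moreover have "a \<noteq> P ! i"
        using a Y3(1) P_not_Y(2)[of i a] i(1) h(1) by auto
      ultimately have "adj c (P ! i) a"
        using adj_total' adj_sym by blast
      then show False
        using centre[of i a] i a by (auto simp: Y3_def)
    qed
    then show ?thesis
      using i by blast
  qed
  obtain z where z: "z \<in> comp (\<not> c) ({1..n} - F') e'" "z \<in> Y3"
    using entry(2)[OF Y3(1)] big cY3 q unfolding K_def by fastforce
  have "\<exists>xs. pth (\<not> c) xs \<and> xs \<noteq> [] \<and> hd xs = e' \<and> last xs \<in> exits (\<not> c) n \<and> set xs \<subseteq> {1..n} - F' \<and>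
      2 * length ws + 1 \<le> length xs + (8 * card F' + 22)"
  proof (rule long_path[where Y = Y3, OF Y3(2) _ z])
    show "Y3 \<subseteq> {1..n} - F'"
      using Y3(1) Y(2) by blast
    show "sorted_wrt (\<lambda>w w'. wset w \<inter> wset w' = {}) ws"
      unfolding ws_def sorted_wrt_map idx_def
      by (intro sorted_wrt_filter sorted_wrt_mono_rel[OF _ sorted_wrt_upt]) (use h(1) in \<open>auto simp: wset_def P_distinct\<close>)
    show "wset w \<inter> Y3 = {}" if "w \<in> set ws" for w
      using ws_adj[OF that] Y3(1) P_not_Y(1) h(1) by (auto simp: wset_def)
    show "\<exists>x\<in>wset w. adj (\<not> c) a x" if "w \<in> set ws" "a \<in> Y3" for w a
      using ws_adj[OF that(1)] that(2) by (auto simp: wset_def)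
    have "\<exists>x\<in>wset w. adj (\<not> c) a x \<and> adj (\<not> c) b x" if "w \<in> set ws" "a \<in> Y3" "b \<in> Y3" for w a b
      using ws_adj[OF that(1)] that(2,3) by (auto simp: wset_def)
    then show "successively (\<lambda>w w'. \<forall>a\<in>Y3. \<forall>b\<in>Y3. a \<noteq> b \<longrightarrow>
        (\<exists>x\<in>wset w \<union> wset w'. adj (\<not> c) a x \<and> adj (\<not> c) b x)) ws"
      unfolding successively_conv_nth by (meson UnI1 Suc_lessD nth_mem)
    have "\<Union> (wset ` set ws) \<subseteq> set P"
    proof
      fix x
      assume "x \<in> \<Union> (wset ` set ws)"
      then obtain i where "i < h" "x = P ! i"
        using ws_adj by (force simp: wset_def)
      then show "x \<in> set P"
        using h(1) by auto
    qed
    then show "\<Union> (wset ` set ws) - ({1..n} - F') \<subseteq> F'"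
      using P_simps(5) by blast
    show "\<exists>zs. pth (\<not> c) zs \<and> set zs \<subseteq> Y3 - {y} \<and> length zs = 1" if "y \<in> Y3" for y
    proof -
      have "2 \<le> card Y3"
        using big cY3 q K_def by linarith
      then have "\<not> Y3 \<subseteq> {y}"
        using card_mono[of "{y}" Y3] by auto
      then obtain y' where "y' \<in> Y3 - {y}"
        by blast
      then show ?thesis
        by (intro exI[of _ "[y']"]) auto
    qed
    show "\<exists>v\<in>exits (\<not> c) n. v \<in> {1..n} - F' \<and> v \<notin> D \<and> (\<exists>w\<in>Y3 - D. v = w \<or> v \<notin> Y3 \<and> adj (\<not> c) v w)"
      if "finite D" "card D \<le> 1 + 2" for D
      using that cYY3 by (intro exit_near Y3) (auto simp: K_def)
    show "length ws + 1 + 2 \<le> card Y3"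
      using len h big cY3 q K_def by linarith
    have "2 * card F' + 8 \<le> length ws"
      using len h q by linarith
    then show "2 * (card F' + 4) \<le> length ws"
      by simp
  qed (use fin in auto)
  then obtain xs where "route (\<not> c) F' e' n xs" "2 * length ws + 1 \<le> length xs + (8 * card F' + 22)"
    by (auto simp: route_def)
  then show ?thesis
    using len h q by (intro exI[of _ xs]) auto
qed

end

section \<open>Gluing paths and stuck colours\<close>

context edge_colouring
begin

text \<open>The last vertex of \<open>L\<close> is identified with the first one of
  \<open>xs\<close>. The fourth equation keeps track of the vertices used up, among which the
  current end is never counted.\<close>

lemma pth_butlast_append:
  assumes "pth c L" "L \<noteq> []" "pth c xs" "xs \<noteq> []" "hd xs = last L" "set (butlast L) \<inter> set xs = {}"
  shows "pth c (butlast L @ xs)" "hd (butlast L @ xs) = hd L" "last (butlast L @ xs) = last xs"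
    "butlast (butlast L @ xs) = butlast L @ butlast xs"
proof -
  have "L = butlast L @ [last L]"
    using assms(2) by simp
  then have "pth c (butlast L) \<and> (butlast L = [] \<or> adj c (last (butlast L)) (last L))"
    using assms(1) pth_append[of c "butlast L" "[last L]"] by simp
  then show "pth c (butlast L @ xs)"
    unfolding pth_append using assms(3,5,6) by auto
  show "hd (butlast L @ xs) = hd L"
    using assms(2,4,5) by (cases L rule: rev_cases) (auto simp: hd_append)
qed (use assms(4) in \<open>auto simp: butlast_append\<close>)

lemma core_connected:
  assumes "x \<in> core c F" "y \<in> core c F"
  shows "\<exists>n. y \<in> comp c ({1..n} - F) x"
proof -
  obtain n1 where n1: "\<And>n. n1 \<le> n \<Longrightarrow> 1 \<le> n \<and> 2 * n \<le> 3 * card (comp c ({1..n} - F) x)"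
    using assms(1) by (auto simp: core_def)
  obtain n2 where n2: "\<And>n. n2 \<le> n \<Longrightarrow> 1 \<le> n \<and> 2 * n \<le> 3 * card (comp c ({1..n} - F) y)"
    using assms(2) by (auto simp: core_def)
  define n where "n = max n1 n2"
  have "card ({1..n} - F) \<le> n"
    using card_mono[of "{1..n}" "{1..n} - F"] by simp
  then have "card ({1..n} - F) < card (comp c ({1..n} - F) x) + card (comp c ({1..n} - F) y)"
    using n1[of n] n2[of n] by (simp add: n_def)
  then have "comp c ({1..n} - F) x = comp c ({1..n} - F) y"
    by (intro big_comps_eq) auto
  moreover have "comp c ({1..n} - F) y \<noteq> {}"
    using n2[of n] by (auto simp: n_def)
  then have "y \<in> comp c ({1..n} - F) y"
    by (auto simp: comp_def)
  ultimately show ?thesis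
    by auto
qed

end

context giant_colouring
begin

text \<open>The path leads from \<open>e\<close> to the first vertex in the core of the complement
  of \<open>insert e F\<close>. Its earlier vertices lie off that core, hence off the components
  that witness it, so removing them does no damage.\<close>

lemma core_step:
  assumes F: "finite F" and e: "e \<in> core c F"
  shows "\<exists>L. pth c L \<and> 2 \<le> length L \<and> hd L = e \<and> set L \<subseteq> {1..} - F \<and> last L \<in> core c (F \<union> set (butlast L))"
proof -
  obtain z where z: "z \<in> core c (insert e F)"
    using core_nonempty[of "insert e F"] F by blast
  then have "z \<in> core c F"
    using core_antimono[of F "insert e F"] by blast
  then obtain m where m: "z \<in> comp c ({1..m} - F) e"
    using core_connected[OF e] by blast
  obtain L where L: "pth c L" "L \<noteq> []" "hd L = e" "last L \<in> core c (insert e F)" "set L \<subseteq> {1..m} - F"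
    "set (butlast L) \<inter> core c (insert e F) = {}"
    by (rule shortest_path_to_set[OF m z]) blast
  have "e \<notin> core c (insert e F)"
    using core_pos(2) by blast
  then have len: "2 \<le> length L"
    using L(2,3,4) by (cases L; cases "tl L") auto
  obtain n0 where n0: "\<And>n. n0 \<le> n \<Longrightarrow> 1 \<le> n \<and> 2 * n \<le> 3 * card (comp c ({1..n} - insert e F) (last L))"
    using L(4) by (auto simp: core_def)
  have "1 \<le> n \<and> 2 * n \<le> 3 * card (comp c ({1..n} - (F \<union> set (butlast L))) (last L))" if n: "n0 \<le> n" for n
  proof -
    have sub: "comp c ({1..n} - insert e F) (last L) \<subseteq> {1..n} - (F \<union> set (butlast L))"
    proof
      fix y
      assume y: "y \<in> comp c ({1..n} - insert e F) (last L)"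
      then have "y \<in> core c (insert e F)"
        by (rule core_comp[OF L(4)])
      then show "y \<in> {1..n} - (F \<union> set (butlast L))"
        using y comp_subset L(6) by blast
    qed
    have "comp c ({1..n} - insert e F) (last L) \<noteq> {}"
      using n0[OF n] by auto
    then have self: "last L \<in> comp c ({1..n} - insert e F) (last L)"
      by (auto simp: comp_def)
    have "comp c ({1..n} - insert e F) (last L) \<subseteq>
        comp c ({1..n} - insert e F) (last L) \<inter> comp c ({1..n} - (F \<union> set (butlast L))) (last L)"
    proof (rule comp_least)
      show "last L \<in> comp c ({1..n} - insert e F) (last L) \<inter> comp c ({1..n} - (F \<union> set (butlast L))) (last L)"
        using self sub comp_self by blast
      fix y z
      assume yz: "y \<in> comp c ({1..n} - insert e F) (last L) \<inter> comp c ({1..n} - (F \<union> set (butlast L))) (last L)"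
        "z \<in> {1..n} - insert e F" "adj c y z"
      have z1: "z \<in> comp c ({1..n} - insert e F) (last L)"
        by (rule comp_closed[of y]) (use yz in auto)
      have "z \<in> comp c ({1..n} - (F \<union> set (butlast L))) (last L)"
        by (rule comp_closed[of y]) (use yz z1 sub in auto)
      then show "z \<in> comp c ({1..n} - insert e F) (last L) \<inter> comp c ({1..n} - (F \<union> set (butlast L))) (last L)"
        using z1 by simp
    qed
    then have "card (comp c ({1..n} - insert e F) (last L)) \<le>
        card (comp c ({1..n} - (F \<union> set (butlast L))) (last L))"
      by (intro card_mono finite_subset[OF comp_subset]) auto
    then show ?thesis
      using n0[OF n] by linarith
  qed
  then have "last L \<in> core c (F \<union> set (butlast L))"
    unfolding core_def by blast
  then show ?thesis
    using L len by (intro exI[of _ L]) auto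
qed

lemma core_path:
  assumes F: "finite F" and e: "e \<in> core c F"
  shows "\<exists>L. pth c L \<and> L \<noteq> [] \<and> m \<le> length L \<and> hd L = e \<and> set L \<subseteq> {1..} - F \<and>
    last L \<in> core c (F \<union> set (butlast L))"
proof (induction m)
  case 0
  show ?case
    using core_pos[OF e] e by (intro exI[of _ "[e]"]) auto
next
  case (Suc m)
  then obtain L where L: "pth c L" "L \<noteq> []" "m \<le> length L" "hd L = e" "set L \<subseteq> {1..} - F"
    "last L \<in> core c (F \<union> set (butlast L))"
    by blast
  obtain xs where xs: "pth c xs" "2 \<le> length xs" "hd xs = last L" "set xs \<subseteq> {1..} - (F \<union> set (butlast L))"
    "last xs \<in> core c (F \<union> set (butlast L) \<union> set (butlast xs))"
    using core_step[OF _ L(6)] F by blast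
  have xs0: "xs \<noteq> []"
    using xs(2) by auto
  have "set (butlast L) \<inter> set xs = {}"
    using xs(4) by blast
  note app = pth_butlast_append[OF L(1,2) xs(1) xs0 xs(3) this]
  have "set (butlast L @ xs) \<subseteq> {1..} - F"
    using L(5) xs(4) by (auto dest: in_set_butlastD)
  moreover have "last (butlast L @ xs) \<in> core c (F \<union> set (butlast (butlast L @ xs)))"
    using app xs(5) by (simp add: Un_assoc)
  moreover have "Suc m \<le> length (butlast L @ xs)"
    using L(3) xs(2) by simp
  ultimately show ?case
    using app(1,2) L(4) xs0 by (intro exI[of _ "butlast L @ xs"]) auto
qed

text \<open>Take a path with \<open>m\<close> vertices that ends in the core of what is left; it
  does not depend on \<open>n\<close>. The component of its end has more vertices than there are
  non-exits, so the path extends to an exit. This supplies the hypothesis \<open>long\<close> of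
  \<open>longest_route\<close>.\<close>

lemma long_routes_exist:
  assumes F: "finite F" and e: "e \<in> core c F"
  shows "\<exists>n1. \<forall>n\<ge>n1. 3 * card ({1..n} - exits c n) < 2 * n \<longrightarrow> (\<exists>L. route c F e n L \<and> m \<le> length L)"
proof -
  obtain L where L: "pth c L" "L \<noteq> []" "m \<le> length L" "hd L = e" "set L \<subseteq> {1..} - F"
    "last L \<in> core c (F \<union> set (butlast L))"
    using core_path[OF assms] by blast
  obtain n0 where n0: "\<And>n. n0 \<le> n \<Longrightarrow> 1 \<le> n \<and> 2 * n \<le> 3 * card (comp c ({1..n} - (F \<union> set (butlast L))) (last L))"
    using L(6) by (auto simp: core_def)
  have "\<exists>L. route c F e n L \<and> m \<le> length L"
    if n: "max n0 (Max (set L)) \<le> n" and few: "3 * card ({1..n} - exits c n) < 2 * n" for n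
  proof -
    define W where "W = {1..n} - (F \<union> set (butlast L))"
    have "\<not> comp c W (last L) \<subseteq> {1..n} - exits c n"
      using card_mono[of "{1..n} - exits c n" "comp c W (last L)"] few n0[of n] n by (auto simp: W_def)
    then obtain v where v: "v \<in> comp c W (last L)" "v \<in> exits c n"
      using comp_subset[of c W "last L"] by (auto simp: W_def)
    obtain xs where xs: "pth c xs" "xs \<noteq> []" "hd xs = last L" "last xs = v" "set xs \<subseteq> W"
      using comp_path[OF v(1)] by blast
    have "set (butlast L) \<inter> set xs = {}"
      using xs(5) by (auto simp: W_def)
    note app = pth_butlast_append[OF L(1,2) xs(1,2,3) this]
    have "set (butlast L) \<subseteq> {1..n} - F"
    proof
      fix x
      assume "x \<in> set (butlast L)"
      then have "x \<in> set L"
        by (rule in_set_butlastD)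
      then show "x \<in> {1..n} - F"
        using L(5) n order.trans[OF Max_ge[OF finite_set \<open>x \<in> set L\<close>], of n] by auto
    qed
    then have "set (butlast L @ xs) \<subseteq> {1..n} - F"
      using xs(5) by (auto simp: W_def)
    then have "route c F e n (butlast L @ xs)"
      using app xs v L(4) by (simp add: route_def)
    moreover have "m \<le> length (butlast L @ xs)"
      using L(3) xs(2) by (cases xs) auto
    ultimately show ?thesis
      by blast
  qed
  then show ?thesis
    by blast
qed

text \<open>From some \<open>n\<close> on, all routes fall short of 2n/3 by a fixed fraction of
  \<open>n\<close>, about n/(3k). A colour that is never stuck can be continued with a loss as small
  as desired.\<close>

definition stuck :: "bool \<Rightarrow> nat \<Rightarrow> nat set \<Rightarrow> nat \<Rightarrow> bool"
  where "stuck c k F e \<longleftrightarrow> finite F \<and> e \<in> core c F \<and>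
    (\<exists>n0. \<forall>n\<ge>n0. \<forall>L. route c F e n L \<longrightarrow> 3 * length L + n div k < 2 * n)"

text \<open>Allows a common \<open>k\<close> for both colours.\<close>

lemma stuck_mono:
  assumes "stuck c k F e" "k \<le> k'" "1 \<le> k"
  shows "stuck c k' F e"
proof -
  have "n div k' \<le> n div k" for n
    using assms(2,3) by (intro div_le_mono2) auto
  then show ?thesis
    using assms(1) unfolding stuck_def by (meson add_left_mono le_less_trans)
qed

text \<open>Too many non-exits of the other colour would yield, by \<open>few_non_exits\<close>, a
  route of colour \<open>c\<close> at some larger \<open>N\<close> that being stuck forbids.\<close>

lemma stuck_non_exits:
  assumes "stuck c k F e" "1 \<le> k"
  shows "\<exists>n1. \<forall>n\<ge>n1. 3 * card ({1..n} - exits (\<not> c) n) + (n div k) div 2 < 2 * n"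
proof -
  obtain n0 where n0: "\<And>n L. n0 \<le> n \<Longrightarrow> route c F e n L \<Longrightarrow> 3 * length L + n div k < 2 * n"
    using assms(1) by (auto simp: stuck_def)
  have F: "finite F" "e \<in> core c F"
    using assms(1) by (auto simp: stuck_def)
  obtain n1 where n1: "\<And>n. n1 \<le> n \<Longrightarrow> 2 * n \<le> 3 * card ({1..n} - exits (\<not> c) n) + (n div k) div 2 \<Longrightarrow>
      \<exists>N\<ge>n. \<exists>L. route c F e N L \<and> 2 * N \<le> 3 * length L + N div k"
    using few_non_exits[OF F assms(2)] unfolding route_def by blast
  have "3 * card ({1..n} - exits (\<not> c) n) + (n div k) div 2 < 2 * n" if n: "max n0 n1 \<le> n" for n
  proof (rule ccontr)
    assume "\<not> ?thesis"
    then obtain N L where "n \<le> N" "route c F e N L" "2 * N \<le> 3 * length L + N div k"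
      using n1[of n] n by auto
    then show False
      using n0[of N L] n by simp
  qed
  then show ?thesis
    by blast
qed

lemma longest_route_exists:
  assumes "route c F e n L"
  shows "\<exists>P. route c F e n P \<and> (\<forall>L. route c F e n L \<longrightarrow> length L \<le> length P)"
proof -
  have "length L \<le> n" if "route c F e n L" for L
  proof -
    have "card (set L) \<le> card {1..n}"
      using that by (intro card_mono) (auto simp: route_def)
    then show ?thesis
      using that pth_length by (auto simp: route_def)
  qed
  then show ?thesis
    using ex_has_greatest_nat[of "route c F e n" L length "Suc n"] assms by (metis less_Suc_eq_le)
qed

lemma not_both_stuck:
  assumes s: "stuck c k F e" and s': "stuck (\<not> c) k F' e'" and k: "1 \<le> k"
  shows False
proof -
  \<comment> \<open>The bound on \<open>q\<close> in \<open>longest_route\<close>, made symmetric in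
    \<open>F\<close> and \<open>F'\<close>: either colour may have the longer route.\<close>
  define C where "C = 100 * card F + 900 * card F' + 900 * card F + 100 * card F' + 5000"
  have F: "finite F" "e \<in> core c F" "finite F'" "e' \<in> core (\<not> c) F'"
    using s s' by (auto simp: stuck_def)
  obtain n0 where n0: "\<And>n L. n0 \<le> n \<Longrightarrow> route c F e n L \<Longrightarrow> 3 * length L + n div k < 2 * n"
    using s by (auto simp: stuck_def)
  obtain n0' where n0': "\<And>n L. n0' \<le> n \<Longrightarrow> route (\<not> c) F' e' n L \<Longrightarrow> 3 * length L + n div k < 2 * n"
    using s' by (auto simp: stuck_def)
  obtain n1 where n1: "\<And>n. n1 \<le> n \<Longrightarrow> 3 * card ({1..n} - exits (\<not> c) n) + (n div k) div 2 < 2 * n"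
    using stuck_non_exits[OF s k] by blast
  obtain n1' where n1': "\<And>n. n1' \<le> n \<Longrightarrow> 3 * card ({1..n} - exits c n) + (n div k) div 2 < 2 * n"
    using stuck_non_exits[OF s' k] by auto
  obtain n2 where n2: "\<And>n. n2 \<le> n \<Longrightarrow> 3 * card ({1..n} - exits c n) < 2 * n \<Longrightarrow>
      \<exists>L. route c F e n L \<and> C \<le> length L"
    using long_routes_exist[OF F(1,2)] by blast
  obtain n2' where n2': "\<And>n. n2' \<le> n \<Longrightarrow> 3 * card ({1..n} - exits (\<not> c) n) < 2 * n \<Longrightarrow>
      \<exists>L. route (\<not> c) F' e' n L \<and> C \<le> length L"
    using long_routes_exist[OF F(3,4)] by blast
  obtain n3 where n3: "\<And>n. n3 \<le> n \<Longrightarrow> 1 \<le> n \<and> 2 * n \<le> 3 * card (comp c ({1..n} - F) e)"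
    using F(2) by (auto simp: core_def)
  obtain n3' where n3': "\<And>n. n3' \<le> n \<Longrightarrow> 1 \<le> n \<and> 2 * n \<le> 3 * card (comp (\<not> c) ({1..n} - F') e')"
    using F(4) by (auto simp: core_def)
  define n where "n = n0 + n0' + n1 + n1' + n2 + n2' + n3 + n3' + C * k"
  define q where "q = n div k"
  have "C * k \<le> n"
    by (simp add: n_def)
  then have q: "C \<le> q" "q \<le> n"
    using k by (simp_all add: q_def less_eq_div_iff_mult_less_eq)
  have non_exits: "3 * card ({1..n} - exits c n) + q div 2 < 2 * n"
    "3 * card ({1..n} - exits (\<not> c) n) + q div 2 < 2 * n"
    using n1[of n] n1'[of n] by (simp_all add: n_def q_def)
  obtain L where L: "route c F e n L" "C \<le> length L"
    using n2[of n] non_exits by (auto simp: n_def)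
  obtain L' where L': "route (\<not> c) F' e' n L'" "C \<le> length L'"
    using n2'[of n] non_exits by (auto simp: n_def)
  obtain P where P: "route c F e n P" "\<And>L. route c F e n L \<Longrightarrow> length L \<le> length P"
    using longest_route_exists[OF L(1)] by blast
  obtain P' where P': "route (\<not> c) F' e' n P'" "\<And>L. route (\<not> c) F' e' n L \<Longrightarrow> length L \<le> length P'"
    using longest_route_exists[OF L'(1)] by blast
  have len: "C \<le> length P" "C \<le> length P'"
    using L P(2) L' P'(2) le_trans by blast+
  have short_c: "3 * length L + q < 2 * n" if "route c F e n L" for L
    using n0[OF _ that] by (simp add: n_def q_def)
  have short_c': "3 * length L + q < 2 * n" if "route (\<not> c) F' e' n L" for L
    using n0'[OF _ that] by (simp add: n_def q_def)
  have giant: "2 * n \<le> 3 * card (comp c ({1..n} - F) e)" "2 * n \<le> 3 * card (comp (\<not> c) ({1..n} - F') e')"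
    using n3[of n] n3'[of n] by (simp_all add: n_def)
  show False
  proof (cases "length P' \<le> length P")
    case True
    interpret longest_route adj c n q F F' e e' P
    proof
      show "length L \<le> length P" if "route (\<not> c) F' e' n L" for L
        using P'(2)[OF that] True by simp
    qed (use F P short_c len non_exits giant q in \<open>auto simp: C_def\<close>)
    show False
      using long_route' short_c' by (metis not_le)
  next
    case False
    interpret longest_route adj "\<not> c" n q F' F e' e P'
    proof
      show "length L \<le> length P'" if "route (\<not> \<not> c) F e n L" for L
        using P(2)[of L] that False by simp
    qed (use F P' short_c' len non_exits giant q in \<open>auto simp: C_def\<close>)
    show False
      using long_route' short_c by (metis not_le)
  qed
qed

end

section \<open>Infinite paths as limits of finite ones\<close>

lemma initial_count_ge:
  assumes "inj a" "a ` {..<m} \<subseteq> {1..n}"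
  shows "m \<le> initial_count a n"
proof -
  \<comment> \<open>The supremum of natural numbers is meaningful only for a bounded set;
    injectivity provides the bound.\<close>
  have "l \<le> n" if "a ` {..<l} \<subseteq> {1..n}" for l
  proof -
    have "card (a ` {..<l}) \<le> card {1..n}"
      using that by (intro card_mono) auto
    then show ?thesis
      using card_image[of a "{..<l}"] assms(1) inj_on_subset by fastforce
  qed
  then have "bdd_above {m. a ` {..<m} \<subseteq> {1..n}}"
    by (intro bdd_aboveI[of _ n]) auto
  then show ?thesis
    unfolding initial_count_def using assms(2) by (intro cSup_upper) auto
qed

text \<open>If the density were below some y < 2/3, a number \<open>k\<close> with 1/k < 2 - 3y
  would contradict \<open>dense\<close>.\<close>

lemma strong_upper_density_ge:
  assumes "inj a" and dense: "\<And>k N. 1 \<le> k \<Longrightarrow> \<exists>n\<ge>N. \<exists>m. a ` {..<m} \<subseteq> {1..n} \<and> 2 * n \<le> 3 * m + n div k"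
  shows "ereal (2 / 3) \<le> strong_upper_density a"
proof (rule ccontr)
  assume "\<not> ?thesis"
  then have "strong_upper_density a < ereal (2 / 3)"
    by simp
  then obtain y where y: "strong_upper_density a < ereal y" "ereal y < ereal (2 / 3)"
    using ereal_dense2 by blast
  have "\<forall>\<^sub>F n in sequentially. ereal (real (initial_count a n) / real n) < ereal y"
    using y(1) unfolding strong_upper_density_def by (rule Limsup_lessD)
  then obtain N where N: "\<And>n. N \<le> n \<Longrightarrow> real (initial_count a n) / real n < y"
    by (auto simp: eventually_sequentially)
  obtain k where k: "1 / (2 - 3 * y) < real k"
    using reals_Archimedean2 by blast
  have pos: "0 < 2 - 3 * y"
    using y(2) by simp
  then have "0 < 1 / (2 - 3 * y)"
    by simp
  then have k0: "0 < real k"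
    using k by linarith
  then have k1: "1 \<le> k"
    by simp
  have ky: "1 / real k < 2 - 3 * y"
    using k pos k0 by (simp add: field_simps)
  \<comment> \<open>\<open>Suc N\<close> ensures that \<open>n\<close> is positive.\<close>
  obtain n m where n: "Suc N \<le> n" "a ` {..<m} \<subseteq> {1..n}" "2 * n \<le> 3 * m + n div k"
    using dense[OF k1] by blast
  have n0: "0 < real n"
    using n(1) by simp
  have "real (n div k) \<le> real n / real k"
    by (rule of_nat_div_le_of_nat)
  moreover have "2 * real n \<le> 3 * real m + real (n div k)"
    using n(3) by (metis (mono_tags) of_nat_add of_nat_le_iff of_nat_mult of_nat_numeral)
  moreover have "real m \<le> real (initial_count a n)"
    using initial_count_ge[OF assms(1) n(2)] by simp
  moreover have "real (initial_count a n) < y * real n"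
    using N[of n] n(1) n0 by (simp add: field_simps)
  ultimately have "2 * real n < 3 * (y * real n) + real n / real k"
    by linarith
  then have "real n * (2 - 3 * y) < real n * (1 / real k)"
    by (simp add: algebra_simps)
  then have "2 - 3 * y < 1 / real k"
    using n0 by (simp only: mult_less_cancel_left_pos)
  then show False
    using ky by simp
qed

text \<open>\<open>S\<close> holds finite paths with an invariant that lets them be extended.
  Extensions keep the old path as a prefix, so a chain of them has a limit, and the stages witness
  its density.\<close>

lemma limit_of_finite_paths:
  fixes S :: "nat list set" and E :: "nat set set"
  assumes "S \<noteq> {}"
    and S: "\<And>Q. Q \<in> S \<Longrightarrow> distinct Q \<and> 0 \<notin> set Q \<and> successively (\<lambda>x y. {x, y} \<in> E) Q"
    and step: "\<And>Q k N. Q \<in> S \<Longrightarrow> 1 \<le> k \<Longrightarrow>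
      \<exists>n\<ge>N. \<exists>Q'\<in>S. prefix Q Q' \<and> set Q' \<subseteq> {1..n} \<and> 2 * n \<le> 3 * length Q' + n div k"
  shows "\<exists>a. KN_path a \<and> path_edges a \<subseteq> E \<and> ereal (2 / 3) \<le> strong_upper_density a"
proof -
  \<comment> \<open>The bound on \<open>2 * n\<close> implies \<open>n \<le> 3 * length Q'\<close>,
    so \<open>3 * k \<le> n\<close> forces the lengths to tend to infinity.\<close>
  define good where "good k n Q' \<longleftrightarrow> 3 * k \<le> n \<and> set Q' \<subseteq> {1..n} \<and> 2 * n \<le> 3 * length Q' + n div (Suc k)"
    for k n and Q' :: "nat list"
  have "\<exists>f. \<forall>k. f k \<in> S \<and> prefix (f k) (f (Suc k)) \<and> (\<exists>n. good k n (f (Suc k)))"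
  proof (rule dependent_nat_choice)
    show "\<exists>Q. Q \<in> S"
      using assms(1) by blast
    show "\<exists>Q'. Q' \<in> S \<and> prefix Q Q' \<and> (\<exists>n. good k n Q')" if "Q \<in> S" for Q k
      using step[OF that, of "Suc k" "3 * k"] unfolding good_def by auto
  qed
  then obtain f where f: "\<And>k. f k \<in> S" "\<And>k. prefix (f k) (f (Suc k))" "\<And>k. \<exists>n. good k n (f (Suc k))"
    by blast
  have len: "k \<le> length (f (Suc k))" for k
  proof -
    obtain n where n: "good k n (f (Suc k))"
      using f(3) by blast
    have "n div Suc k \<le> n"
      by simp
    then show ?thesis
      using n unfolding good_def by linarith
  qed
  have mono: "prefix (f k) (f l)" if "k \<le> l" for k l
    using that by (induction l rule: dec_induct) (auto intro: f(2) prefix_order.trans)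
  \<comment> \<open>Two steps ahead, because \<open>f (Suc k)\<close> is only known to have length
    at least \<open>k\<close>. By \<open>mono\<close> any longer stage has the same entry.\<close>
  define a where "a i = f (Suc (Suc i)) ! i" for i
  have a: "f k ! i = a i" if "i < length (f k)" for k i
  proof -
    have "i < length (f (Suc (Suc i)))"
      using len[of "Suc i"] by simp
    then show ?thesis
      using mono[of k "Suc (Suc i)"] mono[of "Suc (Suc i)" k] that nle_le[of k "Suc (Suc i)"]
      unfolding a_def prefix_def by (metis nth_append)
  qed
  have al: "i < length (f (Suc (Suc i + j)))" for i j
    using len[of "Suc i + j"] by simp
  have "inj a"
  proof (rule injI)
    fix i j
    assume eq: "a i = a j"
    define k where "k = Suc (Suc (i + j))"
    have ij: "i < length (f k)" "j < length (f k)"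
      using al[of i j] al[of j i] by (auto simp: k_def add.commute)
    then have "f k ! i = f k ! j"
      using a eq by simp
    then show "i = j"
      using S[OF f(1)] ij nth_eq_iff_index_eq by blast
  qed
  moreover have "range a \<subseteq> {1..}"
  proof
    fix x
    assume "x \<in> range a"
    then obtain i where "x = a i"
      by blast
    then have "x \<in> set (f (Suc (Suc i)))"
      using al[of i 0] a by (metis add_0_right nth_mem)
    then show "x \<in> {1..}"
      using S[OF f(1)] by (metis One_nat_def Suc_leI atLeast_iff gr0I)
  qed
  ultimately have path: "KN_path a"
    by (simp add: KN_path_def)
  have "{a i, a (Suc i)} \<in> E" for i
  proof -
    have l: "Suc i < length (f (Suc (Suc (Suc i))))"
      using al[of "Suc i" 0] by simp
    then have "{f (Suc (Suc (Suc i))) ! i, f (Suc (Suc (Suc i))) ! Suc i} \<in> E"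
      using S[OF f(1)] by (simp add: successively_conv_nth)
    then show ?thesis
      using a l by simp
  qed
  then have "path_edges a \<subseteq> E"
    by (auto simp: path_edges_def)
  moreover have "ereal (2 / 3) \<le> strong_upper_density a"
  proof (rule strong_upper_density_ge[OF \<open>inj a\<close>])
    fix k N :: nat
    assume k: "1 \<le> k"
    obtain n where n: "good (k + N) n (f (Suc (k + N)))"
      using f(3) by blast
    have "a ` {..<length (f (Suc (k + N)))} \<subseteq> set (f (Suc (k + N)))"
      using a[of _ "Suc (k + N)"] nth_mem by (metis image_subsetI lessThan_iff)
    moreover have "n div Suc (k + N) \<le> n div k"
      using k by (intro div_le_mono2) auto
    ultimately show "\<exists>n\<ge>N. \<exists>m. a ` {..<m} \<subseteq> {1..n} \<and> 2 * n \<le> 3 * m + n div k"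
      using n unfolding good_def
      by (intro exI[of _ n] conjI exI[of _ "length (f (Suc (k + N)))"]) auto
  qed
  ultimately show ?thesis
    using path by blast
qed

section \<open>One round of extension, in either case\<close>

context edge_colouring
begin

text \<open>Deleting \<open>F\<close> and the used vertices only shrinks the components of the other
  colour, so \<open>multipartite_path\<close> continues from the end of \<open>Q\<close> with about
  2n/3 vertices. The path has to end off \<open>F\<close> to be continued in the same way.\<close>

lemma extension_without_giants:
  assumes F: "finite F" and no_giant: "\<And>N. \<exists>n\<ge>N. \<forall>x. 3 * card (comp (\<not> c) ({1..n} - F) x) < 2 * n"
    and Q: "pth c Q" "Q \<noteq> []" "set Q \<subseteq> {1..}" "last Q \<notin> F" and k: "1 \<le> k"
  shows "\<exists>n\<ge>N. \<exists>Q'. pth c Q' \<and> Q' \<noteq> [] \<and> last Q' \<notin> F \<and> prefix Q Q' \<and> set Q' \<subseteq> {1..n} \<and>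
    2 * n \<le> 3 * length Q' + n div k"
proof -
  define f where "f = card F + length Q"
  \<comment> \<open>Three times the length of the new path misses \<open>2 * n\<close> by at most
    \<open>6 * f + 30\<close>, which \<open>n div k\<close> covers as soon as it is at least
    \<open>C\<close>.\<close>
  define C where "C = 10 * f + 30"
  obtain n where n: "N + Max (set Q) + k * C \<le> n" "\<And>x. 3 * card (comp (\<not> c) ({1..n} - F) x) < 2 * n"
    using no_giant by blast
  have "C * k \<le> n"
    using n(1) by (simp add: mult.commute)
  then have q: "C \<le> n div k" "n div k \<le> n"
    using k by (simp_all add: less_eq_div_iff_mult_less_eq)
  define V where "V = {1..n} - (F \<union> set (butlast Q))"
  have Qn: "set Q \<subseteq> {1..n}"
  proof
    fix x
    assume "x \<in> set Q"
    with order.trans[OF Max_ge[OF finite_set this], of n] show "x \<in> {1..n}"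
      using Q(3) n(1) by auto
  qed
  have eV: "last Q \<in> V"
  proof -
    have "Q = butlast Q @ [last Q]"
      using Q(2) by simp
    then have "last Q \<notin> set (butlast Q)"
      using pth_distinct[OF Q(1)] by (metis disjoint_insert(1) distinct_append list.simps(15))
    then show ?thesis
      using Q(4) subsetD[OF Qn last_in_set[OF Q(2)]] by (simp add: V_def)
  qed
  have "card (F \<union> set (butlast Q)) \<le> f"
    using card_Un_le[of F "set (butlast Q)"] card_length[of "butlast Q"] by (simp add: f_def)
  moreover have "card {1..n} - card (F \<union> set (butlast Q)) \<le> card V"
    unfolding V_def using F by (intro diff_card_le_card_Diff) auto
  ultimately have cV: "n \<le> card V + f"
    by simp
  have fV: "finite V"
    by (simp add: V_def)
  define s where "s = (n - 3 * f - 12) div 3"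
  have s: "3 * s + 3 * f + 12 \<le> n" "n \<le> 3 * s + 3 * f + 15"
    using q unfolding s_def C_def by linarith+
  have "2 \<le> card V"
    using cV q unfolding C_def by linarith
  then have "\<not> V \<subseteq> {last Q}"
    using card_mono[of "{last Q}" V] by auto
  then obtain v where v: "v \<in> V" "last Q \<noteq> v"
    by blast
  have small: "card (comp (\<not> c) V x) + s + 3 \<le> card V" for x
  proof -
    have "V \<subseteq> {1..n} - F"
      by (auto simp: V_def)
    then have "card (comp (\<not> c) V x) \<le> card (comp (\<not> c) ({1..n} - F) x)"
      by (intro card_mono comp_mono finite_subset[OF comp_subset]) auto
    then show ?thesis
      using n(2)[of x] cV s(1) by linarith
  qed
  have "\<exists>xs. pth c xs \<and> xs \<noteq> [] \<and> hd xs = last Q \<and> last xs = v \<and> set xs \<subseteq> V \<and> 2 * s \<le> length xs"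
  proof (rule multipartite_path[OF fV eV v small])
    show "2 * s + 2 \<le> card V" "2 \<le> s"
      using s cV q unfolding C_def by linarith+
  qed
  then obtain xs where xs: "pth c xs" "xs \<noteq> []" "hd xs = last Q" "last xs = v" "set xs \<subseteq> V" "2 * s \<le> length xs"
    by blast
  have "set (butlast Q) \<inter> set xs = {}"
    using xs(5) by (auto simp: V_def)
  note app = pth_butlast_append[OF Q(1,2) xs(1,2,3) this]
  have "xs = last Q # tl xs"
    using xs(2,3) by (cases xs) auto
  then have "butlast Q @ xs = Q @ tl xs"
    using append_butlast_last_id[OF Q(2)] by (metis append.assoc append_Cons append_Nil)
  then have "prefix Q (butlast Q @ xs)"
    by simp
  moreover have "set (butlast Q @ xs) \<subseteq> {1..n}"
    using Qn xs(5) by (auto simp: V_def dest: in_set_butlastD)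
  moreover have "2 * n \<le> 3 * length (butlast Q @ xs) + n div k"
    using xs(6) s q by (simp add: C_def)
  moreover have "last (butlast Q @ xs) \<notin> F"
    using app xs(4) v by (auto simp: V_def)
  moreover have "N \<le> n"
    using n(1) by simp
  ultimately show ?thesis
    using app(1) xs(2) by (intro exI[of _ n] conjI exI[of _ "butlast Q @ xs"]) auto
qed

end

context giant_colouring
begin

text \<open>The end of \<open>Q\<close> and its earlier vertices are the data for which
  \<open>c\<close> is not stuck, so there are good routes for arbitrarily large \<open>n\<close>.
  The route ends in an exit, and this restores the condition on the last vertex.\<close>

lemma extension_unless_stuck:
  assumes not_stuck: "\<And>F e. \<not> stuck c k F e"
    and Q: "pth c Q" "Q \<noteq> []" "set Q \<subseteq> {1..}" "last Q \<in> core c (set (butlast Q))"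
  shows "\<exists>n\<ge>N. \<exists>Q'. pth c Q' \<and> Q' \<noteq> [] \<and> last Q' \<in> core c (set (butlast Q')) \<and> prefix Q Q' \<and>
    set Q' \<subseteq> {1..n} \<and> 2 * n \<le> 3 * length Q' + n div k"
proof -
  obtain n L where n: "max N (Max (set Q)) \<le> n"
    and L: "route c (set (butlast Q)) (last Q) n L" "2 * n \<le> 3 * length L + n div k"
    using not_stuck[of "set (butlast Q)" "last Q"] Q(4) unfolding stuck_def
    by (metis finite_set not_le)
  have L': "pth c L" "L \<noteq> []" "hd L = last Q" "last L \<in> exits c n" "set L \<subseteq> {1..n} - set (butlast Q)"
    using L(1) by (auto simp: route_def)
  have "set (butlast Q) \<inter> set L = {}"
    using L'(5) by blast
  note app = pth_butlast_append[OF Q(1,2) L'(1,2,3) this]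
  have Qn: "set Q \<subseteq> {1..n}"
  proof
    fix x
    assume "x \<in> set Q"
    with order.trans[OF Max_ge[OF finite_set this], of n] show "x \<in> {1..n}"
      using Q(3) n by auto
  qed
  have sub: "set (butlast Q @ L) \<subseteq> {1..n}"
    using Qn L'(5) by (auto dest: in_set_butlastD)
  have "L = butlast L @ [last L]"
    using L'(2) by simp
  then have "butlast Q @ L = (butlast Q @ butlast L) @ [last L]"
    by simp
  then have "last L \<notin> set (butlast Q @ butlast L)"
    using pth_distinct[OF app(1)] by (metis disjoint_insert(1) distinct_append list.simps(15))
  then have "set (butlast (butlast Q @ L)) \<subseteq> {1..n} - {last L}"
    using sub unfolding app(4) by (auto dest: in_set_butlastD)
  then have "last (butlast Q @ L) \<in> core c (set (butlast (butlast Q @ L)))"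
    using L'(4) app(3) subsetD[OF core_antimono] by (simp add: exits_def)
  moreover have "L = last Q # tl L"
    using L'(2,3) by (cases L) auto
  then have "butlast Q @ L = Q @ tl L"
    using append_butlast_last_id[OF Q(2)] by (metis append.assoc append_Cons append_Nil)
  then have "prefix Q (butlast Q @ L)"
    by simp
  ultimately show ?thesis
    using app(1) sub L(2) L'(2) n by (intro exI[of _ n] conjI exI[of _ "butlast Q @ L"]) auto
qed

end

theorem theorem1p7:
  fixes R B :: "nat set set"
  assumes "two_colouring R B"
  shows "\<exists>a. KN_path a \<and> monochromatic_path R B a \<and> strong_upper_density a \<ge> ereal (2 / 3)"
proof -
  \<comment> \<open>Edges at the vertex 0 belong to no colour class and get the colour
    \<open>False\<close> here; paths in \<open>{1..}\<close> never use them.\<close>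
  define adj where "adj c x y \<longleftrightarrow> x \<noteq> y \<and> ({x, y} \<in> R \<longleftrightarrow> c)" for c and x y :: nat
  interpret edge_colouring adj
    by standard (auto simp: adj_def insert_commute)
  define E where "E c = (if c then R else B)" for c
  have adj_E: "{x, y} \<in> E c" if "adj c x y" "x \<noteq> 0" "y \<noteq> 0" for c x y
  proof -
    have "{x, y} \<in> KN_edges"
      using that by (auto simp: KN_edges_def nsets_def adj_def)
    then show ?thesis
      using that assms by (auto simp: two_colouring_def E_def adj_def)
  qed
  have pth_E: "distinct Q \<and> 0 \<notin> set Q \<and> successively (\<lambda>x y. {x, y} \<in> E c) Q" if "pth c Q" "set Q \<subseteq> {1..}" for c Q
  proof (intro conjI)
    show "successively (\<lambda>x y. {x, y} \<in> E c) Q"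
      using that adj_E unfolding pth_def by (auto elim!: successively_mono)
  qed (use that in \<open>auto simp: pth_def\<close>)
  have win: ?thesis if "\<exists>a. KN_path a \<and> path_edges a \<subseteq> E c \<and> ereal (2 / 3) \<le> strong_upper_density a" for c
    using that by (auto simp: monochromatic_path_def E_def split: if_splits)
  show ?thesis
  proof (cases "\<exists>c F. finite F \<and> (\<forall>N. \<exists>n\<ge>N. \<forall>x. 3 * card (comp (\<not> c) ({1..n} - F) x) < 2 * n)")
    case True
    then obtain c F where F: "finite F" "\<And>N. \<exists>n\<ge>N. \<forall>x. 3 * card (comp (\<not> c) ({1..n} - F) x) < 2 * n"
      by blast
    define S where "S = {Q. pth c Q \<and> Q \<noteq> [] \<and> set Q \<subseteq> {1..} \<and> last Q \<notin> F}"
    show ?thesis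
    proof (rule win, rule limit_of_finite_paths[of S])
      obtain x where "x \<notin> insert 0 F"
        using ex_new_if_finite[of "insert 0 F"] F(1) by auto
      then have "[x] \<in> S"
        by (auto simp: S_def)
      then show "S \<noteq> {}"
        by blast
      show "distinct Q \<and> 0 \<notin> set Q \<and> successively (\<lambda>x y. {x, y} \<in> E c) Q" if "Q \<in> S" for Q
        using that pth_E by (auto simp: S_def)
      show "\<exists>n\<ge>N. \<exists>Q'\<in>S. prefix Q Q' \<and> set Q' \<subseteq> {1..n} \<and> 2 * n \<le> 3 * length Q' + n div k"
        if "Q \<in> S" "1 \<le> k" for Q k N
      proof -
        have "\<exists>n\<ge>N. \<exists>Q'. pth c Q' \<and> Q' \<noteq> [] \<and> last Q' \<notin> F \<and> prefix Q Q' \<and> set Q' \<subseteq> {1..n} \<and>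
            2 * n \<le> 3 * length Q' + n div k"
          by (rule extension_without_giants[OF F]) (use that in \<open>auto simp: S_def\<close>)
        then show ?thesis
          by (fastforce simp: S_def)
      qed
    qed
  next
    case False
    interpret giant_colouring adj
    proof
      show "\<exists>n0. \<forall>n\<ge>n0. \<exists>x. 2 * n \<le> 3 * card (comp c ({1..n} - F) x)" if "finite F" for F c
      proof (rule ccontr)
        assume "\<not> ?thesis"
        \<comment> \<open>The double negation matches the case assumption for the colour
          \<open>\<not> c\<close>.\<close>
        then have "\<forall>N. \<exists>n\<ge>N. \<forall>x. 3 * card (comp (\<not> \<not> c) ({1..n} - F) x) < 2 * n"
          by (simp add: not_le)
        then show False
          using False that by blast
      qed
    qed
    \<comment> \<open>One colour must work for all \<open>k\<close>. Otherwise each colour is stuck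
      for some \<open>k\<close>, and both are stuck for the larger one.\<close>
    have "\<exists>c. \<forall>k F e. 1 \<le> k \<longrightarrow> \<not> stuck c k F e"
    proof (rule ccontr)
      assume "\<not> ?thesis"
      then obtain k F e k' F' e' where "1 \<le> k" "stuck True k F e" "1 \<le> k'" "stuck (\<not> True) k' F' e'"
        by meson
      then have "stuck True (max k k') F e" "stuck (\<not> True) (max k k') F' e'" "1 \<le> max k k'"
        using stuck_mono by auto
      then show False
        by (rule not_both_stuck)
    qed
    then obtain c where c: "\<And>k F e. 1 \<le> k \<Longrightarrow> \<not> stuck c k F e"
      by blast
    define S where "S = {Q. pth c Q \<and> Q \<noteq> [] \<and> set Q \<subseteq> {1..} \<and> last Q \<in> core c (set (butlast Q))}"
    show ?thesis
    proof (rule win, rule limit_of_finite_paths[of S])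
      obtain x where "x \<in> core c {}"
        using core_nonempty[of "{}" c] by blast
      then have "[x] \<in> S"
        using core_pos(1) by (auto simp: S_def)
      then show "S \<noteq> {}"
        by blast
      show "distinct Q \<and> 0 \<notin> set Q \<and> successively (\<lambda>x y. {x, y} \<in> E c) Q" if "Q \<in> S" for Q
        using that pth_E by (auto simp: S_def)
      show "\<exists>n\<ge>N. \<exists>Q'\<in>S. prefix Q Q' \<and> set Q' \<subseteq> {1..n} \<and> 2 * n \<le> 3 * length Q' + n div k"
        if "Q \<in> S" "1 \<le> k" for Q k N
      proof -
        have "\<exists>n\<ge>N. \<exists>Q'. pth c Q' \<and> Q' \<noteq> [] \<and> last Q' \<in> core c (set (butlast Q')) \<and> prefix Q Q' \<and>
            set Q' \<subseteq> {1..n} \<and> 2 * n \<le> 3 * length Q' + n div k"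
          by (rule extension_unless_stuck) (use that c in \<open>auto simp: S_def\<close>)
        then show ?thesis
          by (fastforce simp: S_def)
      qed
    qed
  qed
qed

end
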